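(* Run the Unbiased Space Saving sketch with $m$ bins on an i.i.d. stream of items drawn from a discrete distribution with probabilities $p_1 \ge p_2 \ge \cdots$ (item $j$ drawn with probability $p_j$). If $p_1 < 1/m$, then as $t \to \infty$ the set of items labeling the bins of the sketch converges in distribution to a probability proportional to size (PPS) sample of size $m$.
   Context: Unbiased Space Saving sketch with $m$ bins: maintain $m$ bins, each an (item, count) pair, counts initialized to $0$. For each new row with item $x_{new}$: if $x_{new}$ is the label of a bin, increment its count by $1$; otherwise choose a bin with the smallest count $\hat{N}_{min}$ (uniformly at random among all bins sharing the smallest count), increment its count by $1$, and with probability $1/(\hat{N}_{min}+1)$ replace its label by $x_{new}$. A probability proportional to size (PPS) sample of size $m$ from items with sizes (here probabilities) $p_j$ is a random set of items whose marginal inclusion probabilities are proportional to the sizes; here, since $p_1<1/m$, item $j$ is included with probability $m p_j$. *)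

theory Defs
  imports "HOL-Probability.Probability"
begin

text \<open>Items are natural numbers; item j (0-based) has probability pmf D j.
  A sketch state with m bins (indexed 0..<m) is a pair (labels, counts);
  a label None means the bin has not been labelled yet (count 0).\<close>

type_synonym uss_state = "(nat \<Rightarrow> nat option) \<times> (nat \<Rightarrow> nat)"

definition uss_init :: uss_state where
  "uss_init = (\<lambda>_. None, \<lambda>_. 0)"

definition uss_step :: "nat \<Rightarrow> uss_state \<Rightarrow> nat \<Rightarrow> uss_state pmf" where
  "uss_step m s x =
     (let L = fst s; C = snd s in
      if \<exists>i<m. L i = Some x then
        (let i = (SOME i. i < m \<and> L i = Some x) in return_pmf (L, C(i := C i + 1)))
      else
        (let Nmin = Min (C ` {..<m}); B = {i. i < m \<and> C i = Nmin} in
         do { i \<leftarrow> pmf_of_set B;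
              r \<leftarrow> bernoulli_pmf (1 / (real Nmin + 1));
              return_pmf (if r then L(i := Some x) else L, C(i := Nmin + 1)) }))"

primrec uss_dist :: "nat \<Rightarrow> nat pmf \<Rightarrow> nat \<Rightarrow> uss_state pmf" where
  "uss_dist m D 0 = return_pmf uss_init"
| "uss_dist m D (Suc t) = uss_dist m D t \<bind> (\<lambda>s. D \<bind> (\<lambda>x. uss_step m s x))"

definition uss_labels :: "nat \<Rightarrow> uss_state \<Rightarrow> nat set" where
  "uss_labels m s = {x. \<exists>i<m. fst s i = Some x}"

definition is_pps_sample :: "nat \<Rightarrow> (nat \<Rightarrow> real) \<Rightarrow> nat set pmf \<Rightarrow> bool" where
  "is_pps_sample m p \<mu> \<longleftrightarrow>
     (\<forall>S\<in>set_pmf \<mu>. finite S \<and> card S = m) \<and>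
     (\<forall>j. measure_pmf.prob \<mu> {S. j \<in> S} = real m * p j)"

end

theory Submission
  imports Defs
begin

text \<open>
  On the logarithmic time scale the label set follows, up to summable errors, a fixed Markov chain
  on \<open>m\<close>-subsets: label \<open>a\<close> is replaced by a fresh item \<open>x\<close> at rate
  \<open>(1 - m p\<^sub>a) p\<^sub>x / (1 - p(S))\<close>. A bin has to absorb a share \<open>1/m\<close> of the stream: its own label
  provides \<open>p\<^sub>a\<close>, and the rest are hits it receives as the minimal bin. That all counts stay
  within \<open>O(\<surd>t)\<close> of \<open>t/m\<close> follows from \<open>p\<^sub>1 < 1/m\<close> by a second (and fourth) moment
  drift argument.

  A function of the label set, corrected by a small term linear in the count deviations, therefore
  changes in mean by \<open>gen f / t + O(t\<^sup>-\<^sup>3\<^sup>/\<^sup>2)\<close>, where \<open>gen\<close> is the generator of the limit chain. The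
  chain contracts a Lipschitz seminorm, so the mean of \<open>gen f\<close> decays polynomially; hence the increments
  are summable and the mean of every bounded \<open>f\<close> converges, while the mean of \<open>gen f\<close> tends to \<open>0\<close>.
  Since \<open>gen\<close> maps \<open>S \<mapsto> card (S \<inter> A)\<close> to \<open>S \<mapsto> m p(A) - card (S \<inter> A)\<close>, the latter gives both the
  inclusion probabilities and the tightness of the limit.
\<close>

section \<open>Expectations over probability mass functions\<close>

text \<open>The obstacle is that the label set alone is not Markov: which bin is minimal depends on
  the counts, which have a fast motion of their own. The deviation of bin \<open>k\<close> drifts by
  exactly \<open>incprob L C k - 1 / m\<close>, so a term linear in the deviations exchanges the
  momentary chance of being the minimal bin for its long-run share. The order of the error is that
  of a relabelling, \<open>1 / t\<close>, times a relative deviation of the counts,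
  \<open>1 / sqrt t\<close>. The fourth moment deals with an exceptionally small minimal count.
  There the error is only known to be of order \<open>t\<close> before the factor
  \<open>1 / t\<close>, and second moments give this event a probability of order
  \<open>1 / t\<close>, which does not compensate; fourth moments give \<open>1 / t^2\<close>. There
  are infinitely many label sets, so a uniform contraction rate needs a reason:
  \<open>{..<m}\<close> is at most \<open>m\<close> swaps away from any of them, and until it is
  reached some helpful swap has rate at least \<open>gam * pmf D (m - 1)\<close>.\<close>

lemma integrable_pmf_bounded:
  fixes f :: "'a \<Rightarrow> real"
  assumes "\<And>x. x \<in> set_pmf M \<Longrightarrow> \<bar>f x\<bar> \<le> B"
  shows "integrable (measure_pmf M) f"
  by (rule measure_pmf.integrable_const_bound[where B = B]) (use assms in \<open>auto simp: AE_measure_pmf_iff\<close>)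

lemma integrable_pmf_indicator [simp]: "integrable (measure_pmf M) (indicator A :: _ \<Rightarrow> real)"
  by (rule integrable_pmf_bounded[where B = 1]) (simp add: indicator_def)

lemma integral_pmf_mono:
  fixes f g :: "'a \<Rightarrow> real"
  assumes "integrable (measure_pmf M) f" "integrable (measure_pmf M) g"
    and "\<And>x. x \<in> set_pmf M \<Longrightarrow> f x \<le> g x"
  shows "measure_pmf.expectation M f \<le> measure_pmf.expectation M g"
  by (rule integral_mono_AE) (use assms in \<open>auto simp: AE_measure_pmf_iff\<close>)

lemma integral_pmf_cong:
  fixes f g :: "'a \<Rightarrow> real"
  assumes "\<And>x. x \<in> set_pmf M \<Longrightarrow> f x = g x"
  shows "measure_pmf.expectation M f = measure_pmf.expectation M g"
  by (rule integral_cong_AE) (use assms in \<open>auto simp: AE_measure_pmf_iff\<close>)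

lemma integral_pmf_abs_le:
  fixes f :: "'a \<Rightarrow> real"
  assumes "\<And>x. x \<in> set_pmf M \<Longrightarrow> \<bar>f x\<bar> \<le> B"
  shows "\<bar>measure_pmf.expectation M f\<bar> \<le> B"
proof -
  have i: "integrable (measure_pmf M) f" using integrable_pmf_bounded assms by blast
  have "measure_pmf.expectation M f \<le> measure_pmf.expectation M (\<lambda>_. B)"
    by (rule integral_pmf_mono) (use assms i in \<open>auto simp: abs_le_iff\<close>)
  moreover have "measure_pmf.expectation M (\<lambda>_. - B) \<le> measure_pmf.expectation M f"
    by (rule integral_pmf_mono) (use assms i in \<open>auto simp: abs_le_iff minus_le_iff\<close>)
  ultimately show ?thesis by simp
qed

text \<open>Adding \<open>B\<close> makes the integrand nonnegative, so that the bind rule for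
  \<open>nn_integral\<close> applies. The bound is asked for on the support only, because
  observables of the counts are bounded on reachable states only.\<close>

lemma integral_bind_pmf_bounded:
  fixes f :: "'b \<Rightarrow> real"
  assumes B: "\<And>y. y \<in> set_pmf (M \<bind> N) \<Longrightarrow> \<bar>f y\<bar> \<le> B"
  shows "measure_pmf.expectation (M \<bind> N) f =
         measure_pmf.expectation M (\<lambda>x. measure_pmf.expectation (N x) f)"
proof -
  have B': "\<bar>f y\<bar> \<le> B" if "x \<in> set_pmf M" "y \<in> set_pmf (N x)" for x y
    using B that by auto
  have int_shift: "ennreal (measure_pmf.expectation P f + B) = (\<integral>\<^sup>+ y. ennreal (f y + B) \<partial>measure_pmf P)"
    if "\<And>y. y \<in> set_pmf P \<Longrightarrow> \<bar>f y\<bar> \<le> B" for P :: "'b pmf"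
  proof -
    have i: "integrable (measure_pmf P) f" using integrable_pmf_bounded that by blast
    have "(\<integral>\<^sup>+ y. ennreal (f y + B) \<partial>measure_pmf P) = ennreal (measure_pmf.expectation P (\<lambda>y. f y + B))"
      by (rule nn_integral_eq_integral) (use i that in \<open>auto simp: AE_measure_pmf_iff abs_le_iff add.commute add_increasing minus_le_iff neg_le_iff_le real_add_le_0_iff\<close>, smt (verit))
    also have "measure_pmf.expectation P (\<lambda>y. f y + B) = measure_pmf.expectation P f + B"
      using i by simp
    finally show ?thesis by simp
  qed
  define F where "F = (\<lambda>x. measure_pmf.expectation (N x) f)"
  have FB: "\<bar>F x\<bar> \<le> B" if "x \<in> set_pmf M" for x
    unfolding F_def by (rule integral_pmf_abs_le) (use B' that in auto)
  have Fi: "integrable (measure_pmf M) F" using integrable_pmf_bounded FB by blast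
  have "ennreal (measure_pmf.expectation (M \<bind> N) f + B) = (\<integral>\<^sup>+ x. \<integral>\<^sup>+ y. ennreal (f y + B) \<partial>measure_pmf (N x) \<partial>measure_pmf M)"
    using int_shift[of "M \<bind> N"] B by simp
  also have "\<dots> = (\<integral>\<^sup>+ x. ennreal (F x + B) \<partial>measure_pmf M)"
    by (rule nn_integral_cong_AE) (use int_shift B' in \<open>auto simp: AE_measure_pmf_iff F_def\<close>)
  also have "\<dots> = ennreal (measure_pmf.expectation M (\<lambda>x. F x + B))"
    by (rule nn_integral_eq_integral) (use Fi FB in \<open>auto simp: AE_measure_pmf_iff abs_le_iff\<close>, smt (verit))
  also have "\<dots> = ennreal (measure_pmf.expectation M F + B)"
    using Fi by simp
  finally have "ennreal (measure_pmf.expectation (M \<bind> N) f + B) = ennreal (measure_pmf.expectation M F + B)" .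
  moreover have "\<bar>measure_pmf.expectation (M \<bind> N) f\<bar> \<le> B" "\<bar>measure_pmf.expectation M F\<bar> \<le> B"
    using integral_pmf_abs_le B FB by blast+
  ultimately show ?thesis unfolding F_def by (simp add: abs_le_iff minus_le_iff ennreal_inj)
qed

text \<open>The setwise limit \<open>l\<close> inherits finite additivity; \<open>tight\<close>
  keeps mass from escaping, so the point masses of \<open>l\<close> sum to \<open>1\<close>. The
  outcome type may be uncountable (later it is \<open>nat set\<close>), hence the unordered
  sums.\<close>

lemma pmf_limit_exists:
  fixes M :: "nat \<Rightarrow> 'a pmf"
  assumes lim: "\<And>X. (\<lambda>t. measure_pmf.prob (M t) X) \<longlonglongrightarrow> l X"
    and tight: "\<And>e. e > 0 \<Longrightarrow> \<exists>F. finite F \<and> 1 - e \<le> l F"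
  shows "\<exists>\<mu>. \<forall>X. measure_pmf.prob \<mu> X = l X"
proof -
  have l0: "0 \<le> l X" for X
    by (rule LIMSEQ_le_const[OF lim]) auto
  have lun: "l (X \<union> Y) = l X + l Y" if "X \<inter> Y = {}" for X Y
  proof (rule LIMSEQ_unique[OF lim])
    have "measure_pmf.prob (M t) (X \<union> Y) = measure_pmf.prob (M t) X + measure_pmf.prob (M t) Y" for t
      using that by (intro measure_pmf.finite_measure_Union) auto
    then show "(\<lambda>t. measure_pmf.prob (M t) (X \<union> Y)) \<longlonglongrightarrow> l X + l Y"
      using tendsto_add[OF lim lim] by simp
  qed
  have lU: "l UNIV = 1"
    by (rule LIMSEQ_unique[OF lim]) simp
  have lmono: "l X \<le> l Y" if "X \<subseteq> Y" for X Y
    using lun[of X "Y - X"] l0[of "Y - X"] that by (simp add: Un_absorb1)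
  have lcompl: "l (- X) = 1 - l X" for X using lun[of X "- X"] lU by simp
  define q where "q = (\<lambda>x. l {x})"
  have lfin: "sum q F = l F" if "finite F" for F
    using that
  proof induction
    case empty
    then show ?case using lun[of "{}" "{}"] by simp
  next
    case (insert x F)
    then show ?case using lun[of "{x}" F] by (simp add: q_def)
  qed
  have fin_le: "sum q F \<le> 1" if "finite F" for F
    using lfin[OF that] lmono[of F UNIV] lU by simp
  have summ: "q summable_on UNIV"
    by (rule nonneg_bdd_above_summable_on) (auto simp: q_def l0 intro!: bdd_aboveI[of _ 1] fin_le[unfolded q_def])
  have "infsum q UNIV = 1"
  proof (rule antisym)
    show "infsum q UNIV \<le> 1" by (rule infsum_le_finite_sums[OF summ]) (rule fin_le)
    show "1 \<le> infsum q UNIV"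
    proof (rule field_le_epsilon)
      fix e :: real assume "e > 0"
      then obtain F where F: "finite F" "1 - e \<le> l F" using tight by blast
      have "sum q F \<le> infsum q UNIV"
        by (rule finite_sum_le_infsum[OF summ F(1)]) (auto simp: q_def l0)
      then show "1 \<le> infsum q UNIV + e" using F lfin by simp
    qed
  qed
  moreover have abs: "Infinite_Set_Sum.abs_summable_on q UNIV"
    using summ by (simp add: abs_summable_equivalent[symmetric] q_def l0)
  ultimately have nn: "(\<integral>\<^sup>+x. ennreal (q x) \<partial>count_space UNIV) = 1"
    by (subst nn_integral_conv_infsetsum) (auto simp: q_def l0 infsetsum_infsum)
  define \<mu> where "\<mu> = embed_pmf q"
  have pmf: "pmf \<mu> x = q x" for x
    unfolding \<mu>_def by (rule pmf_embed_pmf) (use nn l0 in \<open>auto simp: q_def\<close>)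
  \<comment> \<open>One inequality for all sets is enough: applied to \<open>- X\<close> it yields
    the reverse one for \<open>X\<close>.\<close>
  have ge: "l X \<le> measure_pmf.prob \<mu> X" for X
  proof (rule field_le_epsilon)
    fix e :: real assume "e > 0"
    then obtain F where F: "finite F" "1 - e \<le> l F" using tight by blast
    have "l X \<le> l ((X \<inter> F) \<union> - F)" by (rule lmono) auto
    also have "\<dots> = l (X \<inter> F) + (1 - l F)" using lun[of "X \<inter> F" "- F"] lcompl by auto
    also have "l (X \<inter> F) = measure_pmf.prob \<mu> (X \<inter> F)"
      using F lfin[of "X \<inter> F"] by (simp add: measure_measure_pmf_finite pmf)
    also have "\<dots> \<le> measure_pmf.prob \<mu> X" by (rule measure_pmf.finite_measure_mono) auto
    finally show "l X \<le> measure_pmf.prob \<mu> X + e" using F by simp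
  qed
  have "measure_pmf.prob \<mu> X = l X" for X
    using ge[of X] ge[of "- X"] lcompl[of X] measure_pmf.prob_compl[of X \<mu>] by (simp add: Compl_eq_Diff_UNIV)
  then show ?thesis by blast
qed

section \<open>The limit chain on label sets\<close>

locale pps =fixes m :: nat and D :: "nat pmf"
  assumes m_pos: "m > 0" and anti: "antimono (pmf D)" and small: "pmf D 0 < 1 / real m"
begin

text \<open>The slack in the hypothesis \<open>small\<close>. It is a lower bound both for each
  coefficient \<open>1 - m * pmf D a\<close> and for the mass \<open>1 - P S\<close> outside a label
  set.\<close>

definition gam :: real where "gam = 1 - real m * pmf D 0"

abbreviation P :: "nat set \<Rightarrow> real" where "P \<equiv> measure_pmf.prob D"

definition msets :: "nat set set" where "msets = {S. finite S \<and> card S = m}"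

lemma pmf_le: "pmf D a \<le> pmf D 0"
  using anti by (simp add: antimono_def)

lemma gam_pos: "gam > 0" and gam_le: "gam \<le> 1"
  using small m_pos by (auto simp: gam_def field_simps)

lemma coeff: "gam \<le> 1 - m * pmf D a" "0 \<le> 1 - m * pmf D a" "1 - m * pmf D a \<le> 1"
proof -
  have "m * pmf D a \<le> m * pmf D 0" by (intro mult_left_mono pmf_le) auto
  then show "gam \<le> 1 - m * pmf D a" by (simp add: gam_def)
  then show "0 \<le> 1 - m * pmf D a" using gam_pos by linarith
qed auto

lemma P_msets: "S \<in> msets \<Longrightarrow> P S = (\<Sum>a\<in>S. pmf D a)"
  by (simp add: msets_def measure_measure_pmf_finite)

lemma P_finite_le: 
  assumes "finite S" "card S \<le> m" shows "gam \<le> 1 - P S"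
proof -
  have "P S = (\<Sum>a\<in>S. pmf D a)" by (simp add: assms measure_measure_pmf_finite)
  also have "\<dots> \<le> card S * pmf D 0" using sum_bounded_above[of S "pmf D" "pmf D 0"] pmf_le by simp
  also have "\<dots> \<le> m * pmf D 0" using assms by (intro mult_right_mono) auto
  finally show ?thesis by (simp add: gam_def)
qed

lemma P_le: "S \<in> msets \<Longrightarrow> gam \<le> 1 - P S"
  by (rule P_finite_le) (auto simp: msets_def)

lemma sum_coeff: "S \<in> msets \<Longrightarrow> (\<Sum>a\<in>S. 1 - m * pmf D a) = m * (1 - P S)"
  by (simp add: P_msets sum_subtractf sum_distrib_left algebra_simps) (simp add: msets_def)

text \<open>A zero among the first \<open>m\<close> probabilities would, by monotonicity, confine
  \<open>D\<close> to fewer than \<open>m\<close> items, whose total mass is at most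
  \<open>1 - gam\<close>. Positivity makes \<open>{..<m}\<close> reachable for the limit
  chain.\<close>

lemma pmf_pos: assumes "i < m" shows "pmf D i > 0"
proof (rule ccontr)
  assume "\<not> pmf D i > 0"
  then have z: "pmf D i = 0" using pmf_nonneg[of D i] by linarith
  have "pmf D j = 0" if "j \<ge> i" for j
    using antimonoD[OF anti that] z by (simp add: order_antisym)
  then have "set_pmf D \<subseteq> {..<i}" by (metis lessThan_iff not_le set_pmf_iff subsetI)
  then have "P {..<i} = 1" by (subst measure_pmf.prob_eq_1) (auto simp: AE_measure_pmf_iff)
  moreover have "gam \<le> 1 - P {..<i}" by (rule P_finite_le) (use assms in auto)
  ultimately show False using gam_pos by simp
qed

text \<open>The limit chain is reversible; its stationary law is Sampford's sampling design.\<close>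
definition jump :: "(nat set \<Rightarrow> real) \<Rightarrow> nat set \<Rightarrow> nat \<Rightarrow> real" where
  "jump f S a = measure_pmf.expectation D (\<lambda>x. if x \<in> S then 0 else f (insert x (S - {a})) - f S)"

text \<open>The share \<open>1 / m - pmf D a\<close> of hits as minimal bin times the relabelling
  probability, about \<open>m / t\<close>, gives \<open>(1 - m * pmf D a) / t\<close>. The quotient
  by \<open>1 - P S\<close> is the mean change of \<open>f\<close> when the new label follows
  \<open>D\<close> conditioned on lying outside \<open>S\<close>.\<close>

definition gen :: "(nat set \<Rightarrow> real) \<Rightarrow> nat set \<Rightarrow> real" where
  "gen f S = (\<Sum>a\<in>S. (1 - m * pmf D a) * (jump f S a / (1 - P S)))"

definition bdd :: "(nat set \<Rightarrow> real) \<Rightarrow> real \<Rightarrow> bool" where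
  "bdd f b \<longleftrightarrow> (\<forall>S\<in>msets. \<bar>f S\<bar> \<le> b)"

lemma swap_msets: "S \<in> msets \<Longrightarrow> a \<in> S \<Longrightarrow> x \<notin> S \<Longrightarrow> insert x (S - {a}) \<in> msets"
  using m_pos by (auto simp: msets_def card_Diff_singleton)

lemma bdd_nonneg: "bdd f b \<Longrightarrow> 0 \<le> b"
proof -
  assume "bdd f b"
  moreover have "{..<m} \<in> msets" by (simp add: msets_def)
  ultimately show ?thesis unfolding bdd_def by (smt (verit))
qed

lemma swap_diff_bound:
  "bdd f b \<Longrightarrow> S \<in> msets \<Longrightarrow> a \<in> S \<Longrightarrow> \<bar>if x \<in> S then 0 else f (insert x (S - {a})) - f S\<bar> \<le> 2 * b"
  using swap_msets[of S a x] bdd_nonneg[of f b] unfolding bdd_def by (smt (verit))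

lemma jump_integrable:
  "bdd f b \<Longrightarrow> S \<in> msets \<Longrightarrow> a \<in> S \<Longrightarrow>
    integrable (measure_pmf D) (\<lambda>x. if x \<in> S then 0 else f (insert x (S - {a})) - f S)"
  using swap_diff_bound by (intro integrable_pmf_bounded[where B = "2 * b"]) blast

lemma jump_abs_le: "bdd f b \<Longrightarrow> S \<in> msets \<Longrightarrow> a \<in> S \<Longrightarrow> \<bar>jump f S a\<bar> \<le> 2 * b"
  unfolding jump_def using swap_diff_bound by (intro integral_pmf_abs_le) blast

lemma jump_const [simp]: "jump (\<lambda>_. c) S a = 0"
  by (simp add: jump_def cong: if_cong)

lemma gen_const [simp]: "gen (\<lambda>_. c) S = 0"
  by (simp add: gen_def)

lemma jump_linear:
  assumes "bdd f b" "bdd g b'" "S \<in> msets" "a \<in> S"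
  shows "jump (\<lambda>S. f S + c * g S) S a = jump f S a + c * jump g S a"
proof -
  have "jump (\<lambda>S. f S + c * g S) S a = measure_pmf.expectation D (\<lambda>x. 
     (if x \<in> S then 0 else f (insert x (S - {a})) - f S) + c * (if x \<in> S then 0 else g (insert x (S - {a})) - g S))"
    unfolding jump_def by (rule integral_pmf_cong) (auto simp: algebra_simps)
  also have "\<dots> = jump f S a + c * jump g S a"
    unfolding jump_def using jump_integrable[OF assms(1,3,4)] jump_integrable[OF assms(2,3,4)]
    by simp
  finally show ?thesis .
qed

lemma gen_linear:
  assumes "bdd f b" "bdd g b'" "S \<in> msets"
  shows "gen (\<lambda>S. f S + c * g S) S = gen f S + c * gen g S"
  unfolding gen_def 
  by (simp add: jump_linear[OF assms] sum_distrib_left add_divide_distrib distrib_left sum.distrib mult.left_commute)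

text \<open>Jump rates are nonnegative and their total is \<open>m * (1 - P S)\<close>, at most
  \<open>m\<close>; hence an excess of \<open>e\<close> in every single jump costs at most
  \<open>m * e\<close>.\<close>

lemma gen_mono:
  fixes e :: real
  assumes "bdd f b" "bdd g b'" "S \<in> msets" 
    and le: "\<And>a x. a \<in> S \<Longrightarrow> x \<notin> S \<Longrightarrow>
      f (insert x (S - {a})) - f S \<le> g (insert x (S - {a})) - g S + e" and e: "e \<ge> 0"
  shows "gen f S \<le> gen g S + m * e"
proof -
  have P1: "1 - P S > 0" using P_le[OF assms(3)] gam_pos by linarith
  have j: "jump f S a \<le> jump g S a + e * (1 - P S)" if a: "a \<in> S" for a
  proof -
    have i: "integrable (measure_pmf D) (\<lambda>x. e * (indicator (- S) x :: real))" by simp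
    have "jump f S a \<le> measure_pmf.expectation D (\<lambda>x. (if x \<in> S then 0 else g (insert x (S - {a})) - g S) + e * (indicator (- S) x :: real))"
      unfolding jump_def
      by (intro integral_pmf_mono jump_integrable[OF assms(1,3) a] Bochner_Integration.integrable_add i
           jump_integrable[OF assms(2,3) a]) (use le[OF a] in auto)
    also have "\<dots> = jump g S a + e * P (- S)"
      unfolding jump_def using jump_integrable[OF assms(2,3) a] i by simp
    also have "P (- S) = 1 - P S" using measure_pmf.prob_compl[of S D] by (simp add: Compl_eq_Diff_UNIV)
    finally show ?thesis .
  qed
  have "gen f S \<le> (\<Sum>a\<in>S. (1 - m * pmf D a) * (jump g S a / (1 - P S) + e))"
    unfolding gen_def
  proof (intro sum_mono mult_left_mono coeff)
    fix a assume "a \<in> S"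
    then have "jump f S a / (1 - P S) \<le> (jump g S a + e * (1 - P S)) / (1 - P S)"
      using j P1 by (intro divide_right_mono) auto
    then show "jump f S a / (1 - P S) \<le> jump g S a / (1 - P S) + e"
      using P1 by (simp add: add_divide_distrib)
  qed
  also have "\<dots> = gen g S + m * (1 - P S) * e"
    using sum_coeff[OF assms(3)] by (simp add: gen_def distrib_left sum.distrib flip: sum_distrib_right)
  finally have *: "gen f S \<le> gen g S + m * (1 - P S) * e" .
  have "real m * (1 - P S) \<le> real m * 1"
    by (rule mult_left_mono) (simp_all add: measure_nonneg)
  then have "real m * (1 - P S) * e \<le> real m * 1 * e"
    by (rule mult_right_mono) (rule e)
  with * show ?thesis by simp
qed

lemma gen_abs_le:
  fixes e :: real
  assumes "bdd f b" "S \<in> msets" "e \<ge> 0"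
    and le: "\<And>a x. a \<in> S \<Longrightarrow> x \<notin> S \<Longrightarrow> \<bar>f (insert x (S - {a})) - f S\<bar> \<le> e"
  shows "\<bar>gen f S\<bar> \<le> m * e"
proof -
  have z: "bdd (\<lambda>_. 0) 0" by (simp add: bdd_def)
  have n: "bdd (\<lambda>S. 0 + - 1 * f S) b" using assms(1) by (simp add: bdd_def)
  have "gen f S \<le> gen (\<lambda>_. 0) S + m * e"
    by (rule gen_mono[OF assms(1) z assms(2)]) (use le assms(3) in \<open>simp_all add: abs_le_iff\<close>)
  moreover have "gen (\<lambda>S. 0 + - 1 * f S) S \<le> gen (\<lambda>_. 0) S + m * e"
    by (rule gen_mono[OF n z assms(2)]) (use le assms(3) in \<open>simp_all add: abs_le_iff\<close>)
  moreover have "gen (\<lambda>S. 0 + - 1 * f S) S = - gen f S"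
    using gen_linear[OF z assms(1,2), of "-1"] by simp
  ultimately show ?thesis by simp
qed

lemma gen_bdd: fixes b :: real assumes "bdd f b" shows "bdd (gen f) (2 * real m * b)"
  unfolding bdd_def
proof
  fix S assume S: "S \<in> msets"
  have "\<bar>gen f S\<bar> \<le> m * (2 * b)"
  proof (rule gen_abs_le[OF assms S])
    fix a x assume "a \<in> S" "x \<notin> S"
    then show "\<bar>f (insert x (S - {a})) - f S\<bar> \<le> 2 * b"
      using swap_diff_bound[OF assms S, of a x] by simp
  qed (use bdd_nonneg[OF assms] in simp)
  then show "\<bar>gen f S\<bar> \<le> 2 * real m * b" by simp
qed

lemma bdd_add:
  fixes b b' c :: real
  assumes "bdd f b" "bdd g b'" shows "bdd (\<lambda>S. f S + c * g S) (b + \<bar>c\<bar> * b')"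
  unfolding bdd_def
proof
  fix S assume S: "S \<in> msets"
  have "\<bar>f S + c * g S\<bar> \<le> \<bar>f S\<bar> + \<bar>c\<bar> * \<bar>g S\<bar>" by (metis abs_triangle_ineq abs_mult)
  also have "\<dots> \<le> b + \<bar>c\<bar> * b'"
    using assms S by (intro add_mono mult_left_mono) (auto simp: bdd_def)
  finally show "\<bar>f S + c * g S\<bar> \<le> b + \<bar>c\<bar> * b'" .
qed

section \<open>Weighted distance to the reference set \<open>{..<m}\<close> and contraction\<close>

definition defect :: "nat set \<Rightarrow> nat" where "defect S = card ({..<m} - S)"

text \<open>The numerator bounds from below the rate of a swap that lowers the defect. Of the factor
  \<open>4 * m\<close>, an amount \<open>2 * m\<close> pays for the possible increases of the defect
  in two copies of the chain, and \<open>2 * m\<close> is left as net gain.\<close>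

definition theta :: real where "theta = gam * pmf D (m - 1) / (4 * m)"

text \<open>Concave: a step up from \<open>n\<close> costs \<open>theta ^ n\<close>, a step down
  gains the larger \<open>theta ^ (n - 1)\<close>. With \<open>theta\<close> this small, one helpful
  jump outweighs all harmful ones together.\<close>

definition wt :: "nat \<Rightarrow> real" where "wt n = (\<Sum>k<n. theta ^ k)"

text \<open>The contraction rate. It ensures \<open>kap * wt N <= 2 * m * theta ^ N\<close> for
  \<open>N <= 2 * m\<close>, the largest sum of two defects, which turns the net gain at level
  \<open>N\<close> into a multiple of \<open>wt N\<close>.\<close>

definition kap :: real where "kap = theta ^ (2 * m) * theta"

lemma theta_pos: "theta > 0" and theta_le: "theta \<le> 1" and theta_eq: "gam * pmf D (m - 1) = 4 * m * theta"
proof -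
  show "theta > 0" unfolding theta_def using gam_pos pmf_pos[of "m - 1"] m_pos by simp
  have "gam * pmf D (m - 1) \<le> 1 * 1" using gam_pos gam_le by (intro mult_mono pmf_le_1) auto
  then show "theta \<le> 1" using m_pos by (simp add: theta_def field_simps)
  show "gam * pmf D (m - 1) = 4 * m * theta" using m_pos by (simp add: theta_def)
qed

lemma kap_pos: "kap > 0" and kap_le: "kap \<le> 1"
proof -
  show "kap > 0" unfolding kap_def using theta_pos by simp
  have "theta ^ (2 * m) * theta \<le> 1 * 1"
    using theta_pos theta_le by (intro mult_mono power_le_one) auto
  then show "kap \<le> 1" by (simp add: kap_def)
qed

lemma wt_Suc: "wt (Suc n) = wt n + theta ^ n" by (simp add: wt_def)

lemma wt_mono: "i \<le> j \<Longrightarrow> wt i \<le> wt j"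
  unfolding wt_def by (rule sum_mono2) (use theta_pos in auto)

lemma wt_nonneg: "0 \<le> wt n" using theta_pos by (simp add: wt_def sum_nonneg)

lemma wt_le: "wt n \<le> n"
proof -
  have "wt n \<le> (\<Sum>k<n. 1)" unfolding wt_def
    by (rule sum_mono) (use theta_pos theta_le in \<open>auto intro: power_le_one\<close>)
  then show ?thesis by simp
qed

lemma wt_ge: "n > 0 \<Longrightarrow> 1 \<le> wt n"
  using wt_mono[of 1 n] by (simp add: wt_def)

lemma defect_le: "defect S \<le> m"
  unfolding defect_def using card_mono[of "{..<m}" "{..<m} - S"] by auto

lemma defect_zero: assumes "S \<in> msets" "defect S = 0" shows "S = {..<m}"
proof -
  have "{..<m} \<subseteq> S" using assms(2) by (auto simp: defect_def)
  then show ?thesis using assms(1) card_subset_eq[of S "{..<m}"] by (simp add: msets_def)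
qed

lemma defect_swap: "defect (insert x (S - {a})) \<le> Suc (defect S)"
proof -
  have "card ({..<m} - insert x (S - {a})) \<le> card (insert a ({..<m} - S))"
    by (rule card_mono) auto
  also have "\<dots> \<le> Suc (card ({..<m} - S))" by (simp add: card_insert_le_m1 card_insert_if)
  finally show ?thesis by (simp add: defect_def)
qed

lemma defect_swap_good:
  assumes "a \<notin> {..<m}" "x \<in> {..<m} - S" 
  shows "defect S = Suc (defect (insert x (S - {a})))"
proof -
  have "{..<m} - insert x (S - {a}) = ({..<m} - S) - {x}" using assms by auto
  then show ?thesis using card_Suc_Diff1[of "{..<m} - S" x] assms by (simp add: defect_def)
qed

lemma bdd_wt: "bdd (\<lambda>A. wt (defect A + n)) (m + n)"
  unfolding bdd_def
proof
  fix S
  have "wt (defect S + n) \<le> real (defect S + n)" by (rule wt_le)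
  also have "\<dots> \<le> m + n" using defect_le[of S] by simp
  finally show "\<bar>wt (defect S + n)\<bar> \<le> m + n" using wt_nonneg by simp
qed

text \<open>A jump raises the defect by at most one, and the total jump rate is at most
  \<open>m\<close>. The offset \<open>n\<close> stands for the defect of the other copy, held
  fixed.\<close>

lemma gen_wt_le:
  assumes S: "S \<in> msets"
  shows "gen (\<lambda>A. wt (defect A + n)) S \<le> m * theta ^ (defect S + n)"
proof -
  have "gen (\<lambda>A. wt (defect A + n)) S \<le> gen (\<lambda>_. 0) S + m * theta ^ (defect S + n)"
  proof (rule gen_mono[OF bdd_wt _ S])
    show "bdd (\<lambda>_. 0) 0" by (simp add: bdd_def)
    fix a x
    have "wt (defect (insert x (S - {a})) + n) \<le> wt (Suc (defect S + n))"
      by (rule wt_mono) (use defect_swap[of x S a] in simp)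
    then show "wt (defect (insert x (S - {a})) + n) - wt (defect S + n) \<le> 0 - 0 + theta ^ (defect S + n)"
      by (simp add: wt_Suc)
  qed (use theta_pos in simp)
  then show ?thesis by simp
qed

text \<open>Away from \<open>{..<m}\<close> there are a label \<open>i0\<close> outside it and a
  missing item \<open>x0\<close> in it. Swapping them gains \<open>theta ^ (N - 1)\<close>, and the
  definition of \<open>theta\<close> makes rate times gain at least
  \<open>4 * m * theta ^ N\<close>.\<close>

lemma gen_wt_le_strict:
  assumes S: "S \<in> msets" and pos: "defect S > 0"
  shows "gen (\<lambda>A. wt (defect A + n)) S \<le> m * theta ^ (defect S + n) - 4 * m * theta ^ (defect S + n)"
proof -
  define N where "N = defect S + n"
  define W where "W = (\<lambda>A. wt (defect A + n))"
  have fin: "finite S" "card S = m" using S by (auto simp: msets_def)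
  have P1: "1 - P S > 0" "1 - P S \<le> 1" using P_le[OF S] gam_pos by auto
  have "\<not> S \<subseteq> {..<m}" using fin pos card_subset_eq[of "{..<m}" S] by (auto simp: defect_def)
  then obtain i0 where i0: "i0 \<in> S" "i0 \<notin> {..<m}" by blast
  have "{..<m} - S \<noteq> {}" using pos by (simp add: defect_def card_gt_0_iff)
  then obtain x0 where x0: "x0 \<in> {..<m} - S" by blast
  have NS: "N = Suc (N - 1)" using pos by (simp add: N_def)
  \<comment> \<open>The credit for the single jump from \<open>i0\<close> to \<open>x0\<close>;
    every other jump is charged the worst case \<open>theta ^ N\<close>.\<close>
  define dn where "dn = (\<lambda>a x. if a = i0 then theta ^ (N - 1) * (indicator {x0} x :: real) else 0)"
  have j: "jump W S a \<le> theta ^ N * (1 - P S) - (if a = i0 then theta ^ (N - 1) * pmf D x0 else 0)"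
    if a: "a \<in> S" for a
  proof -
    have b: "bdd W (m + n)" unfolding W_def by (rule bdd_wt)
    have i1: "integrable (measure_pmf D) (\<lambda>x. theta ^ N * (indicator (- S) x :: real))" by simp
    have i2: "integrable (measure_pmf D) (dn a)" unfolding dn_def by (cases "a = i0") auto
    have "jump W S a \<le> measure_pmf.expectation D (\<lambda>x. theta ^ N * indicator (- S) x - dn a x)"
      unfolding jump_def
    proof (intro integral_pmf_mono jump_integrable[OF b S a] Bochner_Integration.integrable_diff i1 i2)
      fix x
      have g: "W (insert x (S - {a})) \<le> wt (Suc N)"
        unfolding W_def by (rule wt_mono) (use defect_swap[of x S a] in \<open>simp add: N_def\<close>)
      have s: "W (insert x0 (S - {i0})) = wt (N - 1)" 
        using defect_swap_good[OF i0(2) x0] by (simp add: W_def N_def)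
      have "W S = wt N" by (simp add: W_def N_def)
      moreover have "wt N = wt (N - 1) + theta ^ (N - 1)" using wt_Suc[of "N - 1"] NS by simp
      moreover have "theta ^ N \<ge> 0" using theta_pos by simp
      ultimately show "(if x \<in> S then 0 else W (insert x (S - {a})) - W S) \<le> theta ^ N * indicator (- S) x - dn a x"
        using g s x0 by (auto simp: dn_def wt_Suc indicator_def)
    qed
    also have "\<dots> = theta ^ N * P (- S) - measure_pmf.expectation D (dn a)"
      using i1 i2 by simp
    also have "measure_pmf.expectation D (dn a) = (if a = i0 then theta ^ (N - 1) * pmf D x0 else 0)"
      by (simp add: dn_def measure_pmf_single)
    also have "P (- S) = 1 - P S" using measure_pmf.prob_compl[of S D] by (simp add: Compl_eq_Diff_UNIV)
    finally show ?thesis .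
  qed
  have "gen W S \<le> (\<Sum>a\<in>S. (1 - m * pmf D a) * theta ^ N - (if a = i0 then (1 - m * pmf D i0) * theta ^ (N - 1) * pmf D x0 / (1 - P S) else 0))"
    unfolding gen_def
  proof (rule sum_mono)
    fix a assume a: "a \<in> S"
    have "(1 - m * pmf D a) * (jump W S a / (1 - P S))
       \<le> (1 - m * pmf D a) * ((theta ^ N * (1 - P S) - (if a = i0 then theta ^ (N - 1) * pmf D x0 else 0)) / (1 - P S))"
      by (intro mult_left_mono divide_right_mono j[OF a] coeff) (use P1 in simp)
    also have "\<dots> = (1 - m * pmf D a) * (theta ^ N - (if a = i0 then theta ^ (N - 1) * pmf D x0 else 0) / (1 - P S))"
      using P1 by (subst diff_divide_distrib) simp
    finally show "(1 - m * pmf D a) * (jump W S a / (1 - P S)) \<le> (1 - m * pmf D a) * theta ^ N - (if a = i0 then (1 - m * pmf D i0) * theta ^ (N - 1) * pmf D x0 / (1 - P S) else 0)"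
      by (cases "a = i0") (simp_all add: right_diff_distrib[of _ "theta ^ N"] mult.assoc)
  qed
  also have "\<dots> = m * (1 - P S) * theta ^ N - (1 - m * pmf D i0) * theta ^ (N - 1) * pmf D x0 / (1 - P S)"
    using fin i0 sum_coeff[OF S] by (simp add: sum_subtractf flip: sum_distrib_right)
  also have "\<dots> \<le> m * theta ^ N - gam * pmf D (m - 1) * theta ^ (N - 1)"
  proof -
    have "real m * (1 - P S) * theta ^ N \<le> real m * 1 * theta ^ N"
      using theta_pos by (intro mult_right_mono mult_left_mono P1(2)) auto
    moreover have "pmf D (m - 1) \<le> pmf D x0" using antimonoD[OF anti, of x0 "m - 1"] x0 by auto
    then have "gam * pmf D (m - 1) \<le> (1 - m * pmf D i0) * pmf D x0"
      using coeff[of i0] by (intro mult_mono) (use gam_pos in auto)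
    then have "gam * pmf D (m - 1) * theta ^ (N - 1) \<le> (1 - m * pmf D i0) * pmf D x0 * theta ^ (N - 1)"
      by (rule mult_right_mono) (use theta_pos in simp)
    \<comment> \<open>Dividing by \<open>1 - P S\<close>, which is at most \<open>1\<close>, only
      raises the credit, so the division may be dropped.\<close>
    moreover have "(1 - m * pmf D i0) * theta ^ (N - 1) * pmf D x0 \<le> (1 - m * pmf D i0) * theta ^ (N - 1) * pmf D x0 / (1 - P S)"
      using P1 coeff[of i0] theta_pos by (simp add: pos_le_divide_eq mult_left_le)
    ultimately show ?thesis by (simp add: mult_ac)
  qed
  also have "gam * pmf D (m - 1) * theta ^ (N - 1) = 4 * m * theta ^ N"
    using NS by (subst theta_eq) (metis mult.assoc power_Suc)
  finally show ?thesis by (simp add: N_def W_def)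
qed

text \<open>The distance vanishes only if both sets are \<open>{..<m}\<close>; it stays positive at
  other pairs with \<open>S = S'\<close>, since copies moving independently leave the diagonal. At
  the pair where it vanishes the bound is trivial because the sets agree.\<close>

definition lip :: "(nat set \<Rightarrow> real) \<Rightarrow> real \<Rightarrow> bool" where
  "lip f c \<longleftrightarrow> (\<forall>S\<in>msets. \<forall>S'\<in>msets. f S - f S' \<le> c * wt (defect S + defect S'))"

lemma lip_abs: "lip f c \<Longrightarrow> S \<in> msets \<Longrightarrow> S' \<in> msets \<Longrightarrow> \<bar>f S - f S'\<bar> \<le> c * wt (defect S + defect S')"
  unfolding lip_def by (smt (verit) add.commute)

text \<open>Two copies of the chain move independently until both sit at \<open>{..<m}\<close>; the concave weight
  makes the coupled distance contract.\<close>
lemma lip_contraction: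
  fixes b c t :: real
  assumes b: "bdd f b" and l: "lip f c" and c: "c \<ge> 0" and t: "t \<ge> 2 * real m"
  shows "lip (\<lambda>S. f S + (1 / t) * gen f S) (c * (1 - kap / t))"
  unfolding lip_def
proof (intro ballI)
  fix S S' assume S: "S \<in> msets" and S': "S' \<in> msets"
  have t0: "t > 0" using t m_pos by simp
  define N where "N = defect S + defect S'"
  \<comment> \<open>Slack of the Lipschitz bound at this pair. After a jump of one copy the bound
    holds again, so \<open>f\<close> grows by at most the growth of \<open>c * wt\<close> plus
    \<open>e\<close>, which is the hypothesis of \<open>gen_mono\<close>.\<close>
  define e where "e = c * wt N - (f S - f S')"
  have e: "e \<ge> 0" using l S S' by (simp add: e_def lip_def N_def)
  have bc: "bdd (\<lambda>A. 0 + c * wt (defect A + n)) (0 + \<bar>c\<bar> * (m + n))" for n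
    by (rule bdd_add[OF _ bdd_wt]) (simp add: bdd_def)
  have gc: "gen (\<lambda>A. 0 + c * wt (defect A + n)) A = c * gen (\<lambda>A. wt (defect A + n)) A" if "A \<in> msets" for n A
    using gen_linear[OF _ bdd_wt that, of "\<lambda>_. 0" 0 c n] by (simp add: bdd_def)
  have nb: "bdd (\<lambda>A. 0 + - 1 * f A) b" using b by (simp add: bdd_def)
  have ng: "gen (\<lambda>A. 0 + - 1 * f A) S' = - gen f S'"
    using gen_linear[OF _ b S', of "\<lambda>_. 0" 0 "-1"] by (simp add: bdd_def)
  have g1: "gen f S \<le> c * gen (\<lambda>A. wt (defect A + defect S')) S + m * e"
    unfolding gc[OF S, symmetric]
  proof (rule gen_mono[OF b bc S _ e])
    fix a x assume "a \<in> S" "x \<notin> S"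
    then have "insert x (S - {a}) \<in> msets" using S swap_msets by blast
    then have "f (insert x (S - {a})) - f S' \<le> c * wt (defect (insert x (S - {a})) + defect S')"
      using l S' by (simp add: lip_def)
    then show "f (insert x (S - {a})) - f S \<le> 0 + c * wt (defect (insert x (S - {a})) + defect S') -
         (0 + c * wt (defect S + defect S')) + e" by (simp add: e_def N_def)
  qed
  have g2: "- gen f S' \<le> c * gen (\<lambda>A. wt (defect A + defect S)) S' + m * e"
    unfolding gc[OF S', symmetric] ng[symmetric]
  proof (rule gen_mono[OF nb bc S' _ e])
    fix a x assume "a \<in> S'" "x \<notin> S'"
    then have "insert x (S' - {a}) \<in> msets" using S' swap_msets by blast
    then have "f S - f (insert x (S' - {a})) \<le> c * wt (defect S + defect (insert x (S' - {a})))"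
      using l S by (simp add: lip_def)
    then show "0 + - 1 * f (insert x (S' - {a})) - (0 + - 1 * f S') \<le> 0 + c * wt (defect (insert x (S' - {a})) + defect S) -
         (0 + c * wt (defect S' + defect S)) + e" by (simp add: e_def N_def add.commute)
  qed
  show "f S + (1 / t) * gen f S - (f S' + (1 / t) * gen f S') \<le> c * (1 - kap / t) * wt (defect S + defect S')"
  proof (cases "N = 0")
    case True
    then have "S = S'" using defect_zero S S' by (metis N_def add_is_0)
    moreover have "wt N = 0" using True by (simp add: wt_def)
    ultimately show ?thesis by (simp add: N_def)
  next
    case False
    have wN: "kap * wt N \<le> 2 * m * theta ^ N"
    proof -
      have "N \<le> 2 * m" using defect_le[of S] defect_le[of S'] by (simp add: N_def)
      have "kap * wt N \<le> theta ^ (2 * m) * (2 * m)"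
        unfolding kap_def mult.assoc
      proof (rule mult_left_mono)
        have "theta * wt N \<le> 1 * real N" by (intro mult_mono wt_le theta_le wt_nonneg) auto
        also have "\<dots> \<le> 2 * m" using \<open>N \<le> 2 * m\<close> by simp
        finally show "theta * wt N \<le> real (2 * m)" by simp
      qed (use theta_pos in simp)
      also have "\<dots> \<le> theta ^ N * (2 * m)"
        using \<open>N \<le> 2 * m\<close> theta_pos theta_le by (intro mult_right_mono power_decreasing) auto
      finally show ?thesis by (simp add: mult_ac)
    qed
    have th: "real m * theta ^ N \<ge> 0" using theta_pos by simp
    have "gen (\<lambda>A. wt (defect A + defect S')) S + gen (\<lambda>A. wt (defect A + defect S)) S' \<le> - kap * wt N"
    proof (cases "defect S = 0")
      case True
      then show ?thesis using False gen_wt_le[OF S, of "defect S'"] gen_wt_le_strict[OF S', of "defect S"] wN th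
        by (simp add: N_def add.commute)
    next
      case nz: False
      then show ?thesis using False gen_wt_le[OF S', of "defect S"] gen_wt_le_strict[OF S, of "defect S'"] wN th
        by (simp add: N_def add.commute)
    qed
    then have "c * (gen (\<lambda>A. wt (defect A + defect S')) S + gen (\<lambda>A. wt (defect A + defect S)) S') \<le> c * (- kap * wt N)"
      using c by (rule mult_left_mono)
    then have "gen f S - gen f S' \<le> - c * kap * wt N + 2 * m * e"
      using g1 g2 by (simp add: algebra_simps)
    then have "(gen f S - gen f S') / t \<le> (- c * kap * wt N + 2 * m * e) / t"
      using t0 by (intro divide_right_mono) auto
    also have "\<dots> = - c * kap * wt N / t + (2 * m / t) * e" by (subst add_divide_distrib) simp
    \<comment> \<open>Here \<open>t >= 2 * m\<close> enters: each copy pays the slack with total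
      rate at most \<open>m\<close>, so in one step of size \<open>1 / t\<close> no more than the
      available \<open>e\<close> is spent.\<close>
    also have "\<dots> \<le> - c * kap * wt N / t + 1 * e"
      using t t0 e by (intro add_left_mono mult_right_mono) auto
    finally have "(gen f S - gen f S') / t \<le> - c * kap * wt N / t + e" by simp
    then show ?thesis unfolding e_def N_def[symmetric] by (simp add: algebra_simps diff_divide_distrib)
  qed
qed

text \<open>The bound depends on the seminorm \<open>c\<close> alone and not on \<open>b\<close>, so
  it shrinks along with \<open>c\<close> when the contraction is iterated.\<close>

lemma lip_gen_bdd: fixes b c :: real assumes "bdd f b" "lip f c" "c \<ge> 0" shows "bdd (gen f) (2 * real m * real m * c)"
  unfolding bdd_def
proof
  fix S assume S: "S \<in> msets"
  have "\<bar>gen f S\<bar> \<le> m * (c * (2 * m))"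
  proof (rule gen_abs_le[OF assms(1) S])
    fix a x assume "a \<in> S" "x \<notin> S"
    then have A: "insert x (S - {a}) \<in> msets" (is "?A \<in> _") using S swap_msets by blast
    have "\<bar>f ?A - f S\<bar> \<le> c * wt (defect ?A + defect S)" by (rule lip_abs[OF assms(2) A S])
    also have "\<dots> \<le> c * (2 * m)"
    proof (rule mult_left_mono[OF _ assms(3)])
      have "wt (defect ?A + defect S) \<le> real (defect ?A + defect S)" by (rule wt_le)
      also have "\<dots> \<le> 2 * m" using defect_le[of ?A] defect_le[of S] by simp
      finally show "wt (defect ?A + defect S) \<le> real (2 * m)" by simp
    qed
    finally show "\<bar>f ?A - f S\<bar> \<le> c * (2 * m)" by simp
  qed (use assms in simp)
  then show "\<bar>gen f S\<bar> \<le> 2 * real m * real m * c" by (simp add: mult_ac)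
qed

text \<open>Unless both sets are \<open>{..<m}\<close>, and hence equal, their distance is at least
  \<open>1\<close>.\<close>

lemma bdd_lip: fixes b :: real assumes "bdd f b" shows "lip f (2 * b)"
  unfolding lip_def
proof (intro ballI)
  fix S S' assume S: "S \<in> msets" "S' \<in> msets"
  show "f S - f S' \<le> 2 * b * wt (defect S + defect S')"
  proof (cases "defect S + defect S' = 0")
    case True
    then have "S = S'" using defect_zero S by (metis add_is_0)
    then show ?thesis using True by (simp add: wt_def)
  next
    case False
    then have "2 * b * 1 \<le> 2 * b * wt (defect S + defect S')"
      using bdd_nonneg[OF assms] by (intro mult_left_mono wt_ge) auto
    moreover have "f S - f S' \<le> 2 * b" using assms S unfolding bdd_def by (smt (verit))
    ultimately show ?thesis by linarith
  qed
qed

text \<open>A swap of \<open>a\<close> for \<open>x\<close> changes the count by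
  \<open>indicator A x - indicator A a\<close>. Gains sum to \<open>m * P (A - S)\<close>, losses to
  \<open>card (S \<inter> A) - m * P (S \<inter> A)\<close>; the two terms in \<open>P\<close>
  combine to \<open>m * P A\<close>, which is free of \<open>S\<close>.\<close>

lemma gen_card_inter:
  assumes S: "S \<in> msets"
  shows "gen (\<lambda>S. real (card (S \<inter> A))) S = m * P A - card (S \<inter> A)"
proof -
  have fin: "finite S" using S by (simp add: msets_def)
  have P1: "1 - P S > 0" using P_le[OF S] gam_pos by linarith
  have j: "jump (\<lambda>S. real (card (S \<inter> A))) S a = P (A - S) - indicator A a * (1 - P S)" if a: "a \<in> S" for a
  proof -
    have "jump (\<lambda>S. real (card (S \<inter> A))) S a = measure_pmf.expectation D (\<lambda>x. indicator (A - S) x - indicator A a * indicator (- S) x)"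
      unfolding jump_def
    proof (rule integral_pmf_cong)
      fix x
      have "card ((S - {a}) \<inter> A) = card (S \<inter> A) - (if a \<in> A then 1 else 0)"
        using a fin by (auto simp: Diff_Int_distrib2 card_Diff_singleton_if)
      moreover have "card (S \<inter> A) \<ge> (if a \<in> A then 1 else 0)"
        using a fin by (auto simp: Suc_le_eq card_gt_0_iff)
      moreover have "card (insert x (S - {a}) \<inter> A) = card ((S - {a}) \<inter> A) + (if x \<in> A then 1 else 0)" if "x \<notin> S"
        using that fin by (auto simp: card_insert_if Int_insert_left)
      ultimately show "(if x \<in> S then 0 else real (card (insert x (S - {a}) \<inter> A)) - real (card (S \<inter> A)))
         = indicator (A - S) x - indicator A a * indicator (- S) x"
        by (auto simp: indicator_def of_nat_diff)
    qed
    also have "\<dots> = P (A - S) - indicator A a * P (- S)" by simp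
    also have "P (- S) = 1 - P S" using measure_pmf.prob_compl[of S D] by (simp add: Compl_eq_Diff_UNIV)
    finally show ?thesis .
  qed
  have "gen (\<lambda>S. real (card (S \<inter> A))) S = (\<Sum>a\<in>S. (1 - m * pmf D a) * (P (A - S) / (1 - P S)) - (1 - m * pmf D a) * indicator A a)"
    unfolding gen_def
  proof (rule sum.cong)
    fix a assume "a \<in> S"
    have "(P (A - S) - indicator A a * (1 - P S)) / (1 - P S) = P (A - S) / (1 - P S) - indicator A a"
      using P1 by (subst diff_divide_distrib) simp
    then show "(1 - m * pmf D a) * (jump (\<lambda>S. real (card (S \<inter> A))) S a / (1 - P S)) =
        (1 - m * pmf D a) * (P (A - S) / (1 - P S)) - (1 - m * pmf D a) * indicator A a"
      unfolding j[OF \<open>a \<in> S\<close>] by (simp only: right_diff_distrib)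
  qed simp
  also have "\<dots> = m * P (A - S) - (\<Sum>a\<in>S. (1 - m * pmf D a) * indicator A a)"
    using P1 by (simp only: sum_subtractf[of "\<lambda>a. _ a * _"] sum_distrib_right[symmetric] sum_coeff[OF S]) simp
  also have "(\<Sum>a\<in>S. (1 - m * pmf D a) * indicator A a) = (\<Sum>a\<in>S \<inter> A. 1 - m * pmf D a)"
    using fin by (simp add: sum.inter_restrict indicator_def if_distrib cong: if_cong)
  also have "\<dots> = card (S \<inter> A) - m * P (S \<inter> A)"
    using fin by (simp add: sum_subtractf measure_measure_pmf_finite sum_distrib_left)
  also have "P (A - S) = P A - P (S \<inter> A)"
    using measure_pmf.finite_measure_Diff'[of A D S] by (simp add: Int_commute)
  finally show ?thesis by (simp add: algebra_simps)
qed

section \<open>The sketch and its count deviations\<close>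

definition total :: "nat \<Rightarrow> uss_state \<Rightarrow> bool" where
  "total t s \<longleftrightarrow> (\<Sum>k<m. snd s k) = t"

text \<open>Invariant of reachable states. Distinct labels determine the \<open>SOME\<close> in
  \<open>uss_step\<close>; the last clause makes every bin of positive count labelled.\<close>

definition valid :: "nat \<Rightarrow> uss_state \<Rightarrow> bool" where
  "valid t s \<longleftrightarrow> total t s \<and>
     (\<forall>i<m. \<forall>j<m. \<forall>x. fst s i = Some x \<longrightarrow> fst s j = Some x \<longrightarrow> i = j) \<and>
     (\<forall>k<m. fst s k = None \<longrightarrow> snd s k = 0)"

definition bump :: "(nat \<Rightarrow> nat) \<Rightarrow> nat \<Rightarrow> nat \<Rightarrow> nat" where
  "bump C k = C(k := Suc (C k))"

definition mincount :: "(nat \<Rightarrow> nat) \<Rightarrow> nat" where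
  "mincount C = Min (C ` {..<m})"

definition minbins :: "(nat \<Rightarrow> nat) \<Rightarrow> nat set" where
  "minbins C = {i. i < m \<and> C i = mincount C}"

definition minprob :: "(nat \<Rightarrow> nat) \<Rightarrow> nat \<Rightarrow> real" where
  "minprob C k = (if C k = mincount C then 1 / card (minbins C) else 0)"

definition lprob :: "(nat \<Rightarrow> nat option) \<Rightarrow> nat \<Rightarrow> real" where
  "lprob L k = P {x. L k = Some x}"

definition incprob :: "(nat \<Rightarrow> nat option) \<Rightarrow> (nat \<Rightarrow> nat) \<Rightarrow> nat \<Rightarrow> real" where
  "incprob L C k = lprob L k + (1 - P (uss_labels m (L, C))) * minprob C k"

definition next_state :: "uss_state \<Rightarrow> uss_state pmf" where
  "next_state s = D \<bind> (\<lambda>x. uss_step m s x)"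

lemma mincount_le: "k < m \<Longrightarrow> mincount C \<le> C k"
  by (simp add: mincount_def)

lemma minbins_finite: "finite (minbins C)" and minbins_ne: "minbins C \<noteq> {}" 
proof -
  show "finite (minbins C)" by (simp add: minbins_def)
  have "mincount C \<in> C ` {..<m}" unfolding mincount_def using m_pos by (intro Min_in) auto
  then show "minbins C \<noteq> {}" by (auto simp: minbins_def)
qed

lemma minprob_nonneg: "minprob C k \<ge> 0" by (simp add: minprob_def)

lemma sum_minprob_gen: "(\<Sum>k<m. minprob C k * g k) = (\<Sum>k\<in>minbins C. g k) / card (minbins C)"
proof -
  have "(\<Sum>k<m. minprob C k * g k) = (\<Sum>k\<in>minbins C. g k / card (minbins C))"
    by (rule sum.mono_neutral_cong_right) (auto simp: minbins_def minprob_def)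
  then show ?thesis by (simp add: sum_divide_distrib)
qed

lemma sum_minprob: "(\<Sum>k<m. minprob C k) = 1"
  using sum_minprob_gen[of C "\<lambda>_. 1"] minbins_finite minbins_ne by simp

lemma step_hit:
  assumes "valid t (L, C)" "i < m" "L i = Some x"
  shows "uss_step m (L, C) x = return_pmf (L, bump C i)"
proof -
  have "(SOME i. i < m \<and> L i = Some x) = i"
    by (rule some_equality) (use assms in \<open>auto simp: valid_def\<close>)
  then show ?thesis using assms by (auto simp: uss_step_def bump_def Let_def)
qed

lemma step_miss:
  assumes "x \<notin> uss_labels m (L, C)"
  shows "uss_step m (L, C) x = pmf_of_set (minbins C) \<bind> (\<lambda>i. bernoulli_pmf (1 / (real (mincount C) + 1)) \<bind>
     (\<lambda>r. return_pmf (if r then L(i := Some x) else L, bump C i)))"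
proof -
  have "\<not> (\<exists>i<m. L i = Some x)" using assms by (auto simp: uss_labels_def)
  then have "uss_step m (L, C) x = pmf_of_set (minbins C) \<bind> (\<lambda>i. bernoulli_pmf (1 / (real (mincount C) + 1)) \<bind>
     (\<lambda>r. return_pmf (if r then L(i := Some x) else L, C(i := mincount C + 1))))"
    by (simp only: uss_step_def minbins_def mincount_def Let_def fst_conv snd_conv if_False)
  also have "\<dots> = pmf_of_set (minbins C) \<bind> (\<lambda>i. bernoulli_pmf (1 / (real (mincount C) + 1)) \<bind>
     (\<lambda>r. return_pmf (if r then L(i := Some x) else L, bump C i)))"
    by (rule bind_pmf_cong) (use minbins_finite minbins_ne in \<open>auto simp: bump_def minbins_def\<close>)
  finally show ?thesis .
qed

lemma step_miss_expectation:
  fixes \<phi> :: "uss_state \<Rightarrow> real"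
  assumes "x \<notin> uss_labels m (L, C)"
  shows "measure_pmf.expectation (uss_step m (L, C) x) \<phi> =
    (\<Sum>k<m. minprob C k * \<phi> (L, bump C k)) +
    (\<Sum>k<m. minprob C k / (real (mincount C) + 1) * (\<phi> (L(k := Some x), bump C k) - \<phi> (L, bump C k)))"
proof -
  define q where "q = 1 / (real (mincount C) + 1)"
  have q: "0 \<le> q" "q \<le> 1" by (auto simp: q_def)
  have inner: "measure_pmf.expectation (bernoulli_pmf q \<bind> (\<lambda>r. return_pmf (if r then L(i := Some x) else L, bump C i))) \<phi>
     = \<phi> (L, bump C i) + q * (\<phi> (L(i := Some x), bump C i) - \<phi> (L, bump C i))" for i
    using q by (subst pmf_expectation_bind[where A = UNIV]) (auto simp: UNIV_bool algebra_simps)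
  have "measure_pmf.expectation (uss_step m (L, C) x) \<phi> =
     (\<Sum>k\<in>minbins C. (\<phi> (L, bump C k) + q * (\<phi> (L(k := Some x), bump C k) - \<phi> (L, bump C k))) /\<^sub>R real (card (minbins C)))"
    unfolding step_miss[OF assms] q_def[symmetric]
    by (subst pmf_expectation_bind_pmf_of_set) (use minbins_finite minbins_ne inner in \<open>auto\<close>)
  also have "\<dots> = (\<Sum>k<m. minprob C k * (\<phi> (L, bump C k) + q * (\<phi> (L(k := Some x), bump C k) - \<phi> (L, bump C k))))"
    unfolding sum_minprob_gen by (simp add: sum_distrib_left field_simps flip: sum_divide_distrib)
  finally show ?thesis
    by (simp add: q_def distrib_left sum.distrib)
qed

lemma total_bump: "total t (L, C) \<Longrightarrow> k < m \<Longrightarrow> total (Suc t) (L', bump C k)"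
proof -
  assume a: "total t (L, C)" "k < m"
  have "(\<Sum>j<m. bump C k j) = (\<Sum>j<m. C j + (if j = k then 1 else 0))"
    by (rule sum.cong) (auto simp: bump_def)
  also have "\<dots> = t + 1" using a by (simp add: sum.distrib total_def)
  finally show ?thesis by (simp add: total_def)
qed

lemma valid_step:
  assumes i: "valid t s" and s': "s' \<in> set_pmf (uss_step m s x)"
  shows "valid (Suc t) s'"
proof -
  obtain L C where s: "s = (L, C)" by fastforce
  have tot: "total t (L, C)" using i s by (simp add: valid_def)
  show ?thesis
  proof (cases "x \<in> uss_labels m (L, C)")
    case True
    then obtain j where j: "j < m" "L j = Some x" by (auto simp: uss_labels_def)
    have "s' = (L, bump C j)" using step_hit[of t L C j x] j i s s' by simp
    then show ?thesis using i s j total_bump[OF tot j(1)] by (auto simp: valid_def bump_def)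
  next
    case False
    obtain k r where k: "k \<in> minbins C" "r \<in> set_pmf (bernoulli_pmf (1 / (real (mincount C) + 1)))" 
      and s'': "s' = (if r then L(k := Some x) else L, bump C k)"
      using s' minbins_finite minbins_ne unfolding s step_miss[OF False] by auto
    have km: "k < m" "C k = mincount C" using k by (auto simp: minbins_def)
    \<comment> \<open>An unlabelled minimal bin has count \<open>0\<close>, so its relabelling
      probability is \<open>1\<close> and the coin is forced; otherwise it would end up with count
      \<open>1\<close> and no label.\<close>
    have r: "r" if "L k = None"
    proof -
      have "mincount C = 0" using i s that km by (simp add: valid_def)
      then show r using k(2) by (cases r) (auto simp: set_pmf_eq)
    qed
    show ?thesis using i r False total_bump[OF tot km(1)] unfolding s s''
      by (auto simp: valid_def bump_def uss_labels_def split: if_splits)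
  qed
qed

lemma valid_next_state: "valid t s \<Longrightarrow> s' \<in> set_pmf (next_state s) \<Longrightarrow> valid (Suc t) s'"
  unfolding next_state_def set_bind_pmf using valid_step by blast

lemma valid_dist: "s \<in> set_pmf (uss_dist m D t) \<Longrightarrow> valid t s"
proof (induction t arbitrary: s)
  case 0
  then show ?case by (simp add: uss_init_def valid_def total_def)
next
  case (Suc t)
  then show ?case using valid_step unfolding uss_dist.simps set_bind_pmf by blast
qed

lemma total_dist: "s \<in> set_pmf (uss_dist m D t) \<Longrightarrow> total t s"
  using valid_dist unfolding valid_def by blast

lemma total_next_state: "valid t s \<Longrightarrow> s' \<in> set_pmf (next_state s) \<Longrightarrow> total (Suc t) s'"
  using valid_next_state unfolding valid_def by blast

lemma expectation_Suc:
  fixes \<phi> :: "uss_state \<Rightarrow> real"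
  assumes "\<And>s. total (Suc t) s \<Longrightarrow> \<bar>\<phi> s\<bar> \<le> B"
  shows "measure_pmf.expectation (uss_dist m D (Suc t)) \<phi> =
    measure_pmf.expectation (uss_dist m D t) (\<lambda>s. measure_pmf.expectation (next_state s) \<phi>)"
proof -
  have "measure_pmf.expectation (uss_dist m D t \<bind> next_state) \<phi> =
    measure_pmf.expectation (uss_dist m D t) (\<lambda>s. measure_pmf.expectation (next_state s) \<phi>)"
  proof (rule integral_bind_pmf_bounded)
    fix s assume "s \<in> set_pmf (uss_dist m D t \<bind> next_state)"
    then show "\<bar>\<phi> s\<bar> \<le> B" using valid_dist total_next_state assms unfolding set_bind_pmf by blast
  qed
  then show ?thesis by (simp add: next_state_def[abs_def])
qed

lemma sum_lprob: assumes "valid t (L, C)" shows "(\<Sum>k<m. lprob L k) = P (uss_labels m (L, C))"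
proof -
  have "uss_labels m (L, C) = (\<Union>k<m. {x. L k = Some x})" by (auto simp: uss_labels_def)
  moreover have "P (\<Union>k<m. {x. L k = Some x}) = (\<Sum>k<m. lprob L k)"
    unfolding lprob_def
    by (rule measure_pmf.finite_measure_finite_Union) (use assms in \<open>auto simp: valid_def disjoint_family_on_def\<close>)
  ultimately show ?thesis by simp
qed

lemma lprob_le: "lprob L k \<le> pmf D 0" and lprob_nonneg: "lprob L k \<ge> 0"
proof -
  show "lprob L k \<ge> 0" by (simp add: lprob_def)
  show "lprob L k \<le> pmf D 0"
    using pmf_le by (cases "L k") (auto simp: lprob_def measure_pmf_single eq_commute)
qed

lemma sum_incprob: "valid t (L, C) \<Longrightarrow> (\<Sum>k<m. incprob L C k) = 1"
  by (simp add: incprob_def sum.distrib sum_lprob sum_minprob flip: sum_distrib_left)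

lemma incprob_nonneg: "incprob L C k \<ge> 0"
  by (simp add: incprob_def lprob_nonneg minprob_nonneg)

text \<open>Separates the two effects of a row: the first sum contains the increment with labels
  unchanged, the second the correction for relabelling, which carries the small weight
  \<open>1 / (mincount C + 1)\<close>.\<close>

lemma next_state_expectation:
  fixes \<phi> :: "uss_state \<Rightarrow> real"
  assumes i: "valid t (L, C)" and B: "\<And>s. total (Suc t) s \<Longrightarrow> \<bar>\<phi> s\<bar> \<le> B"
  shows "measure_pmf.expectation (next_state (L, C)) \<phi> =
    (\<Sum>k<m. incprob L C k * \<phi> (L, bump C k)) +
    (\<Sum>k<m. minprob C k / (real (mincount C) + 1) *
      measure_pmf.expectation D (\<lambda>x. if x \<in> uss_labels m (L, C) then 0 else \<phi> (L(k := Some x), bump C k) - \<phi> (L, bump C k)))"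
proof -
  define S where "S = uss_labels m (L, C)"
  define df where "df = (\<lambda>k x. if x \<in> S then 0 else \<phi> (L(k := Some x), bump C k) - \<phi> (L, bump C k))"
  have tot: "total t (L, C)" using i by (simp add: valid_def)
  have Bb: "\<bar>\<phi> (L', bump C k)\<bar> \<le> B" if "k < m" for L' k
    using B total_bump[OF tot that] by blast
  have B0: "B \<ge> 0" using order_trans[OF abs_ge_zero Bb[of 0 L]] m_pos by simp
  have dfi: "integrable (measure_pmf D) (df k)" if "k < m" for k
  proof (rule integrable_pmf_bounded)
    fix x
    show "\<bar>df k x\<bar> \<le> 2 * B"
      using B0 Bb[OF that, of "L(k := Some x)"] Bb[OF that, of L] unfolding df_def by auto
  qed
  \<comment> \<open>Hits and misses in one formula for all \<open>x\<close>: indicators select the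
    case, so the average over \<open>D\<close> is taken term by term.\<close>
  have F: "measure_pmf.expectation (uss_step m (L, C) x) \<phi> =
      (\<Sum>k<m. indicator {x. L k = Some x} x * \<phi> (L, bump C k)) 
      + (\<Sum>k<m. indicator (- S) x * (minprob C k * \<phi> (L, bump C k)))
      + (\<Sum>k<m. minprob C k / (real (mincount C) + 1) * df k x)" for x
  proof (cases "x \<in> S")
    case True
    then obtain j where j: "j < m" "L j = Some x" by (auto simp: S_def uss_labels_def)
    have "(\<Sum>k<m. indicator {x. L k = Some x} x * \<phi> (L, bump C k)) = (\<Sum>k<m. if k = j then \<phi> (L, bump C k) else 0)"
      by (rule sum.cong) (use i j in \<open>auto simp: valid_def indicator_def\<close>)
    then show ?thesis using True step_hit[OF i j] j by (simp add: df_def)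
  next
    case False
    have "(\<Sum>k<m. indicator {x. L k = Some x} x * \<phi> (L, bump C k)) = 0"
      by (rule sum.neutral) (use False in \<open>auto simp: S_def uss_labels_def\<close>)
    then show ?thesis using False step_miss_expectation[of x L C \<phi>] by (simp add: S_def df_def)
  qed
  have "measure_pmf.expectation (next_state (L, C)) \<phi> =
      measure_pmf.expectation D (\<lambda>x. measure_pmf.expectation (uss_step m (L, C) x) \<phi>)"
    unfolding next_state_def
  proof (rule integral_bind_pmf_bounded)
    fix s assume "s \<in> set_pmf (D \<bind> uss_step m (L, C))"
    then have "s \<in> set_pmf (next_state (L, C))" by (simp add: next_state_def)
    then show "\<bar>\<phi> s\<bar> \<le> B" using total_next_state[OF i] B by blast
  qed
  also have "\<dots> = (\<Sum>k<m. lprob L k * \<phi> (L, bump C k)) + (\<Sum>k<m. P (- S) * (minprob C k * \<phi> (L, bump C k)))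
      + (\<Sum>k<m. minprob C k / (real (mincount C) + 1) * measure_pmf.expectation D (df k))"
  proof -
    have sum: "integrable (measure_pmf D) (\<lambda>x. \<Sum>k<m. g k x)"
      "measure_pmf.expectation D (\<lambda>x. \<Sum>k<m. g k x) = (\<Sum>k<m. measure_pmf.expectation D (g k))"
      if "\<And>k. k < m \<Longrightarrow> integrable (measure_pmf D) (g k)" for g :: "nat \<Rightarrow> nat \<Rightarrow> real"
      by (rule Bochner_Integration.integrable_sum, simp add: that)
         (rule Bochner_Integration.integral_sum, simp add: that)
    have i1: "integrable (measure_pmf D) (\<lambda>x. indicator {x. L k = Some x} x * \<phi> (L, bump C k))" for k
      by (intro integrable_mult_left) simp
    have i2: "integrable (measure_pmf D) (\<lambda>x. indicator (- S) x * (minprob C k * \<phi> (L, bump C k)))" for k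
      by (intro integrable_mult_left) simp
    have i3: "integrable (measure_pmf D) (\<lambda>x. minprob C k / (real (mincount C) + 1) * df k x)" if "k < m" for k
      by (intro integrable_mult_right dfi that)
    have add3: "measure_pmf.expectation D (\<lambda>x. a x + b x + c x) =
        measure_pmf.expectation D a + measure_pmf.expectation D b + measure_pmf.expectation D c"
      if "integrable (measure_pmf D) a" "integrable (measure_pmf D) b" "integrable (measure_pmf D) c"
      for a b c :: "nat \<Rightarrow> real"
      using that by simp
    have e1: "measure_pmf.expectation D (\<lambda>x. \<Sum>k<m. indicator {x. L k = Some x} x * \<phi> (L, bump C k)) = (\<Sum>k<m. lprob L k * \<phi> (L, bump C k))"
      by (subst sum(2)[OF i1]) (simp_all only: integral_mult_left_zero, simp add: lprob_def)
    have e2: "measure_pmf.expectation D (\<lambda>x. \<Sum>k<m. indicator (- S) x * (minprob C k * \<phi> (L, bump C k))) = (\<Sum>k<m. P (- S) * (minprob C k * \<phi> (L, bump C k)))"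
      by (subst sum(2)[OF i2]) (simp_all only: integral_mult_left_zero, simp)
    have e3: "measure_pmf.expectation D (\<lambda>x. \<Sum>k<m. minprob C k / (real (mincount C) + 1) * df k x) = (\<Sum>k<m. minprob C k / (real (mincount C) + 1) * measure_pmf.expectation D (df k))"
      by (subst sum(2)[OF i3]) (simp_all only: integral_mult_right_zero)
    show ?thesis
      unfolding F e1[symmetric] e2[symmetric] e3[symmetric]
      by (rule add3) (intro sum(1) i1 i2 i3, (assumption)?)+
  qed
  also have "P (- S) = 1 - P S" using measure_pmf.prob_compl[of S D] by (simp add: Compl_eq_Diff_UNIV)
  also have "(\<Sum>k<m. lprob L k * \<phi> (L, bump C k)) + (\<Sum>k<m. (1 - P S) * (minprob C k * \<phi> (L, bump C k)))
      = (\<Sum>k<m. incprob L C k * \<phi> (L, bump C k))"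
    unfolding sum.distrib[symmetric] by (rule sum.cong) (simp_all add: incprob_def S_def distrib_right)
  finally show ?thesis by (simp add: df_def S_def)
qed

lemma next_state_expectation_counts:
  fixes \<phi> :: "uss_state \<Rightarrow> real"
  assumes i: "valid t (L, C)" and B: "\<And>s. total (Suc t) s \<Longrightarrow> \<bar>\<phi> s\<bar> \<le> B"
    and c: "\<And>L L' C. \<phi> (L, C) = \<phi> (L', C)"
  shows "measure_pmf.expectation (next_state (L, C)) \<phi> = (\<Sum>k<m. incprob L C k * \<phi> (L, bump C k))"
proof -
  have "\<phi> (L(k := Some x), bump C k) - \<phi> (L, bump C k) = 0" for k x using c by simp
  then show ?thesis by (subst next_state_expectation[OF i, of \<phi> B]) (erule B, simp cong: if_cong)
qed

section \<open>Deviations of the counts from \<open>t / m\<close> and their moments\<close>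

definition dev :: "nat \<Rightarrow> uss_state \<Rightarrow> nat \<Rightarrow> real" where
  "dev t s k = real (snd s k) - t / m"

definition sqdev :: "nat \<Rightarrow> uss_state \<Rightarrow> real" where
  "sqdev t s = (\<Sum>k<m. (dev t s k)\<^sup>2)"

definition absdev :: "nat \<Rightarrow> uss_state \<Rightarrow> real" where
  "absdev t s = (\<Sum>k<m. \<bar>dev t s k\<bar>)"

lemma dev_bump: "dev (Suc t) (L', bump C k) j = dev t (L, C) j - 1 / m + (if j = k then 1 else 0)"
  by (simp add: dev_def bump_def add_divide_distrib)

lemma sum_dev: "total t s \<Longrightarrow> (\<Sum>k<m. dev t s k) = 0"
  using m_pos by (simp add: dev_def sum_subtractf total_def flip: of_nat_sum)

lemma abs_dev_le: assumes "total t s" "k < m" shows "\<bar>dev t s k\<bar> \<le> t"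
proof -
  have "snd s k \<le> t" using assms member_le_sum[of k "{..<m}" "snd s"] by (simp add: total_def)
  moreover have "real t / m \<le> t / 1" using m_pos by (intro divide_left_mono) auto
  ultimately show ?thesis unfolding dev_def by (simp add: abs_le_iff) (smt (verit) divide_nonneg_nonneg of_nat_0_le_iff of_nat_mono)
qed

lemma sqdev_nonneg: "sqdev t s \<ge> 0" by (simp add: sqdev_def sum_nonneg)
lemma absdev_nonneg: "absdev t s \<ge> 0" by (simp add: absdev_def sum_nonneg)

lemma abs_dev_absdev: "k < m \<Longrightarrow> \<bar>dev t s k\<bar> \<le> absdev t s"
  unfolding absdev_def by (rule member_le_sum) auto

lemma dev_sqdev: "k < m \<Longrightarrow> (dev t s k)\<^sup>2 \<le> sqdev t s"
  unfolding sqdev_def by (rule member_le_sum) auto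

lemma absdev_le: "total t s \<Longrightarrow> absdev t s \<le> m * t"
  unfolding absdev_def using sum_bounded_above[of "{..<m}" "\<lambda>k. \<bar>dev t s k\<bar>" "real t"] abs_dev_le by simp

lemma sqdev_le: assumes "total t s" shows "sqdev t s \<le> m * t\<^sup>2"
proof -
  have "(dev t s k)\<^sup>2 \<le> (real t)\<^sup>2" if "k < m" for k
    using abs_dev_le[OF assms that] by (metis abs_ge_zero power2_abs power_mono)
  then show ?thesis unfolding sqdev_def using sum_bounded_above[of "{..<m}" "\<lambda>k. (dev t s k)\<^sup>2" "(real t)\<^sup>2"] by simp
qed

text \<open>Recentring from \<open>t / m\<close> to \<open>(t + 1) / m\<close> has no first-order
  effect since the deviations sum to \<open>0\<close>; only the deviation of the incremented bin
  remains.\<close>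

lemma sqdev_bump:
  assumes tot: "total t (L, C)" and k: "k < m"
  shows "sqdev (Suc t) (L', bump C k) = sqdev t (L, C) + 2 * dev t (L, C) k + 1 - 1 / m"
proof -
  let ?z = "dev t (L, C)"
  have "sqdev (Suc t) (L', bump C k) = (\<Sum>j<m. (?z j)\<^sup>2 - 2 / m * ?z j + 1 / (real m)\<^sup>2 + (if j = k then 2 * ?z j - 2 / m + 1 else 0))"
    unfolding sqdev_def dev_bump[where L = L] by (rule sum.cong) (auto simp: power2_eq_square algebra_simps)
  also have "\<dots> = sqdev t (L, C) - 2 / m * (\<Sum>j<m. ?z j) + m * (1 / (real m)\<^sup>2) + (2 * ?z k - 2 / m + 1)"
    using k by (simp add: sum.distrib sum_subtractf sqdev_def sum_distrib_left)
  also have "\<dots> = sqdev t (L, C) + 2 * ?z k + 1 - 1 / m"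
    using sum_dev[OF tot] m_pos by (simp add: power2_eq_square)
  finally show ?thesis .
qed

text \<open>No label is drawn more often than a fair share \<open>1/m\<close> and the minimal bin is below average,
  so on average the incremented bin is below the mean.\<close>
lemma incprob_dev_le:
  assumes i: "valid t (L, C)"
  shows "(\<Sum>k<m. incprob L C k * dev t (L, C) k) \<le> 0"
proof -
  define N where "N = real (mincount C)"
  let ?c = "N - t / m"
  have tot: "(\<Sum>k<m. C k) = t" using i by (simp add: valid_def total_def)
  have mp: "minprob C k * dev t (L, C) k = minprob C k * ?c" for k
    by (auto simp: minprob_def dev_def N_def)
  have "(\<Sum>k<m. incprob L C k * dev t (L, C) k) = 
      (\<Sum>k<m. lprob L k * (real (C k) - N) + lprob L k * ?c + (1 - P (uss_labels m (L, C))) * (minprob C k * dev t (L, C) k))"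
  proof (rule sum.cong)
    fix k
    have "lprob L k * dev t (L, C) k = lprob L k * (real (C k) - N) + lprob L k * ?c"
      by (simp add: dev_def flip: distrib_left)
    then show "incprob L C k * dev t (L, C) k = lprob L k * (real (C k) - N) + lprob L k * ?c +
        (1 - P (uss_labels m (L, C))) * (minprob C k * dev t (L, C) k)"
      by (simp add: incprob_def distrib_right mult.assoc)
  qed simp
  also have "\<dots> = (\<Sum>k<m. lprob L k * (real (C k) - N)) + ?c"
    unfolding mp sum.distrib sum_distrib_left[symmetric] sum_distrib_right[symmetric] sum_lprob[OF i] sum_minprob
    by (simp add: left_diff_distrib)
  \<comment> \<open>Measured from the minimum all differences are nonnegative, so each label
    probability may be raised to the largest one. This produces the factor
    \<open>pmf D 0 - 1 / m\<close>, negative by hypothesis.\<close>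
  also have "(\<Sum>k<m. lprob L k * (real (C k) - N)) \<le> (\<Sum>k<m. pmf D 0 * (real (C k) - N))"
    by (intro sum_mono mult_right_mono lprob_le) (auto simp: N_def mincount_le)
  also have "\<dots> = pmf D 0 * (t - m * N)"
    using tot by (simp add: sum_subtractf flip: sum_distrib_left of_nat_sum)
  also have "pmf D 0 * (t - m * N) + ?c = (pmf D 0 - 1 / m) * (t - m * N)"
    using m_pos by (simp add: field_simps)
  also have "\<dots> \<le> 0"
  proof (rule mult_nonpos_nonneg)
    have "(\<Sum>k<m. mincount C) \<le> (\<Sum>k<m. C k)" by (intro sum_mono mincount_le) auto
    then have "m * mincount C \<le> t" using tot by simp
    then show "0 \<le> real t - m * N" unfolding N_def by (metis diff_ge_0_iff_ge of_nat_le_iff of_nat_mult)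
  qed (use small in simp)
  finally show ?thesis by simp
qed

abbreviation E :: "nat \<Rightarrow> (uss_state \<Rightarrow> real) \<Rightarrow> real" where
  "E t \<equiv> measure_pmf.expectation (uss_dist m D t)"

lemma integrable_total:
  fixes \<phi> :: "uss_state \<Rightarrow> real"
  assumes "\<And>s. total t s \<Longrightarrow> \<bar>\<phi> s\<bar> \<le> B"
  shows "integrable (measure_pmf (uss_dist m D t)) \<phi>"
  by (rule integrable_pmf_bounded[where B = B]) (blast intro: assms total_dist)

lemma sqdev_integrable: "integrable (measure_pmf (uss_dist m D t)) (sqdev t)"
  by (rule integrable_total[where B = "m * t\<^sup>2"]) (simp add: sqdev_le sqdev_nonneg del: of_nat_mult)

lemma sqdev2_le: "total t s \<Longrightarrow> \<bar>(sqdev t s)\<^sup>2\<bar> \<le> (m * t\<^sup>2)\<^sup>2"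
  using sqdev_le[of t s] sqdev_nonneg[of t s] power_mono[of "sqdev t s" "real (m * t\<^sup>2)" 2] by simp

lemma sqdev2_integrable: "integrable (measure_pmf (uss_dist m D t)) (\<lambda>s. (sqdev t s)\<^sup>2)"
  by (rule integrable_total) (rule sqdev2_le)

lemma absdev_integrable: "integrable (measure_pmf (uss_dist m D t)) (absdev t)"
  by (rule integrable_total[where B = "m * t"]) (simp add: absdev_le absdev_nonneg del: of_nat_mult)

lemma E_mono:
  assumes "integrable (measure_pmf (uss_dist m D t)) f" "integrable (measure_pmf (uss_dist m D t)) g"
    and "\<And>s. valid t s \<Longrightarrow> f s \<le> g s"
  shows "E t f \<le> E t g"
  by (rule integral_pmf_mono) (blast intro: assms valid_dist)+

lemma next_state_integrable:
  fixes \<phi> :: "uss_state \<Rightarrow> real"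
  assumes "\<And>s. total (Suc t) s \<Longrightarrow> \<bar>\<phi> s\<bar> \<le> B"
  shows "integrable (measure_pmf (uss_dist m D t)) (\<lambda>s. measure_pmf.expectation (next_state s) \<phi>)"
proof (rule integrable_pmf_bounded)
  fix s assume "s \<in> set_pmf (uss_dist m D t)"
  then show "\<bar>measure_pmf.expectation (next_state s) \<phi>\<bar> \<le> B"
    by (intro integral_pmf_abs_le) (blast intro: assms valid_dist total_next_state)
qed

lemma next_state_sqdev:
  assumes i: "valid t (L, C)"
  shows "measure_pmf.expectation (next_state (L, C)) (sqdev (Suc t)) \<le> sqdev t (L, C) + 1"
proof -
  have tot: "total t (L, C)" using i by (simp add: valid_def)
  have "measure_pmf.expectation (next_state (L, C)) (sqdev (Suc t)) = (\<Sum>k<m. incprob L C k * sqdev (Suc t) (L, bump C k))"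
    by (rule next_state_expectation_counts[OF i, where B = "m * (Suc t)\<^sup>2"])
       (simp add: sqdev_le sqdev_nonneg del: of_nat_mult, simp add: sqdev_def dev_def)
  also have "\<dots> = (\<Sum>k<m. incprob L C k * (sqdev t (L, C) + 1 - 1 / m) + 2 * (incprob L C k * dev t (L, C) k))"
    by (rule sum.cong) (simp_all add: sqdev_bump[OF tot] algebra_simps)
  also have "\<dots> = sqdev t (L, C) + 1 - 1 / m + 2 * (\<Sum>k<m. incprob L C k * dev t (L, C) k)"
    unfolding sum.distrib using sum_incprob[OF i] by (simp flip: sum_distrib_left sum_distrib_right)
  also have "\<dots> \<le> sqdev t (L, C) + 1"
  proof -
    have "1 / real m \<ge> 0" by simp
    then show ?thesis using incprob_dev_le[OF i] by linarith
  qed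
  finally show ?thesis .
qed

lemma next_state_sqdev2:
  assumes i: "valid t (L, C)"
  shows "measure_pmf.expectation (next_state (L, C)) (\<lambda>s. (sqdev (Suc t) s)\<^sup>2) \<le> (sqdev t (L, C))\<^sup>2 + 10 * sqdev t (L, C) + 2"
proof -
  have tot: "total t (L, C)" using i by (simp add: valid_def)
  let ?V = "sqdev t (L, C)"
  have "measure_pmf.expectation (next_state (L, C)) (\<lambda>s. (sqdev (Suc t) s)\<^sup>2) = (\<Sum>k<m. incprob L C k * (sqdev (Suc t) (L, bump C k))\<^sup>2)"
    by (rule next_state_expectation_counts[OF i, where B = "(m * (Suc t)\<^sup>2)\<^sup>2"])
       (erule sqdev2_le, simp add: sqdev_def dev_def)
  also have "\<dots> \<le> (\<Sum>k<m. incprob L C k * (?V\<^sup>2 + 10 * ?V + 2) + (4 * ?V) * (incprob L C k * dev t (L, C) k))"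
  proof (rule sum_mono)
    fix k assume "k \<in> {..<m}"
    then have k: "k < m" by simp
    define a where "a = 1 - 1 / real m"
    define z where "z = dev t (L, C) k"
    have a: "0 \<le> a" "a \<le> 1" using m_pos by (auto simp: a_def)
    have z: "z\<^sup>2 \<le> ?V" unfolding z_def by (rule dev_sqdev[OF k])
    have "sqdev (Suc t) (L, bump C k) = ?V + (2 * z + a)" using sqdev_bump[OF tot k] by (simp add: a_def z_def)
    \<comment> \<open>The cross term \<open>4 * ?V * z\<close> is kept apart because its average
      over \<open>k\<close> is nonpositive. The rest is at most \<open>2 * ?V\<close> from
      \<open>a <= 1\<close> plus \<open>8 * ?V + 2\<close> from the last square.\<close>
    moreover have "(?V + (2 * z + a))\<^sup>2 \<le> ?V\<^sup>2 + 10 * ?V + 2 + 4 * ?V * z"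
    proof -
      have "(?V + (2 * z + a))\<^sup>2 = ?V\<^sup>2 + 4 * ?V * z + 2 * ?V * a + (2 * z + a)\<^sup>2"
        by (simp add: power2_eq_square algebra_simps)
      moreover have "?V * a \<le> ?V * 1" using a sqdev_nonneg by (intro mult_left_mono) auto
      moreover have "(2 * z + a)\<^sup>2 \<le> 8 * z\<^sup>2 + 2 * a\<^sup>2"
        using zero_le_power2[of "2 * z - a"] by (simp add: power2_eq_square algebra_simps)
      moreover have "a\<^sup>2 \<le> 1" using a by (simp add: power_le_one)
      ultimately show ?thesis using z by linarith
    qed
    ultimately have "incprob L C k * (sqdev (Suc t) (L, bump C k))\<^sup>2 \<le> incprob L C k * (?V\<^sup>2 + 10 * ?V + 2 + 4 * ?V * z)"
      using incprob_nonneg by (intro mult_left_mono) auto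
    then show "incprob L C k * (sqdev (Suc t) (L, bump C k))\<^sup>2 \<le> incprob L C k * (?V\<^sup>2 + 10 * ?V + 2) + (4 * ?V) * (incprob L C k * dev t (L, C) k)"
      by (simp add: z_def algebra_simps)
  qed
  also have "\<dots> = ?V\<^sup>2 + 10 * ?V + 2 + (4 * ?V) * (\<Sum>k<m. incprob L C k * dev t (L, C) k)"
    unfolding sum.distrib using sum_incprob[OF i] by (simp flip: sum_distrib_left sum_distrib_right)
  also have "\<dots> \<le> ?V\<^sup>2 + 10 * ?V + 2" using incprob_dev_le[OF i] sqdev_nonneg by (simp add: mult_nonneg_nonpos)
  finally show ?thesis .
qed

lemma E_sqdev: "E t (sqdev t) \<le> t"
proof (induction t)
  case 0
  then show ?case by (simp add: uss_init_def sqdev_def dev_def)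
next
  case (Suc t)
  have b: "\<bar>sqdev (Suc t) s\<bar> \<le> m * (Suc t)\<^sup>2" if "total (Suc t) s" for s
    using sqdev_le[OF that] sqdev_nonneg by simp
  have "E (Suc t) (sqdev (Suc t)) = E t (\<lambda>s. measure_pmf.expectation (next_state s) (sqdev (Suc t)))"
    by (rule expectation_Suc[OF b])
  also have "\<dots> \<le> E t (\<lambda>s. sqdev t s + 1)"
    by (intro E_mono next_state_integrable[OF b] Bochner_Integration.integrable_add sqdev_integrable)
       (auto simp: split_paired_all intro: next_state_sqdev)
  also have "\<dots> \<le> Suc t" using Suc sqdev_integrable by simp
  finally show ?case .
qed

lemma E_sqdev2: "E t (\<lambda>s. (sqdev t s)\<^sup>2) \<le> 7 * (real t)\<^sup>2"
proof (induction t)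
  case 0
  then show ?case by (simp add: uss_init_def sqdev_def dev_def)
next
  case (Suc t)
  note i = sqdev_integrable[of t] sqdev2_integrable[of t]
  have "E (Suc t) (\<lambda>s. (sqdev (Suc t) s)\<^sup>2) = E t (\<lambda>s. measure_pmf.expectation (next_state s) (\<lambda>s. (sqdev (Suc t) s)\<^sup>2))"
    by (rule expectation_Suc[OF sqdev2_le])
  also have "\<dots> \<le> E t (\<lambda>s. (sqdev t s)\<^sup>2 + 10 * sqdev t s + 2)"
    by (intro E_mono next_state_integrable[OF sqdev2_le]) (use i in \<open>auto simp: split_paired_all intro: next_state_sqdev2\<close>)
  also have "\<dots> = E t (\<lambda>s. (sqdev t s)\<^sup>2) + 10 * E t (sqdev t) + 2" using i by simp
  also have "\<dots> \<le> 7 * (real t)\<^sup>2 + 10 * t + 2" using Suc E_sqdev[of t] by simp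
  \<comment> \<open>The increment \<open>10 * t + 2\<close>, obtained from the second moment bound,
    stays below \<open>14 * t + 7\<close>, the increment of \<open>7 * t^2\<close>.\<close>
  also have "\<dots> \<le> 7 * (real (Suc t))\<^sup>2" by (simp add: power2_eq_square algebra_simps)
  finally show ?case by simp
qed

section \<open>The corrected observable and its drift\<close>

text \<open>Relative error of replacing the relabelling probability \<open>1 / (N + 1)\<close> by
  \<open>m / t\<close>, up to a constant factor. The added ones keep it finite and cover the shift
  from \<open>t\<close> to \<open>t + 1\<close>.\<close>

definition risk :: "nat \<Rightarrow> uss_state \<Rightarrow> real" where
  "risk t s = (absdev t s + 1) / (real (mincount (snd s)) + 1)"

text \<open>The value \<open>{..<m}\<close> is a placeholder for the early phase, when some bin has no label yet.\<close>
definition lab :: "uss_state \<Rightarrow> nat set" where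
  "lab s = (if uss_labels m s \<in> msets then uss_labels m s else {..<m})"

definition corr :: "nat \<Rightarrow> (nat set \<Rightarrow> real) \<Rightarrow> uss_state \<Rightarrow> real" where
  "corr t f s = (if uss_labels m s \<in> msets
     then \<Sum>k<m. dev t s k * (jump f (uss_labels m s) (the (fst s k)) / (1 - P (uss_labels m s))) else 0)"

text \<open>The corrector \<open>corr\<close> averages out the fast motion of the counts: its drift turns the
  instantaneous replacement rate of a bin into the stationary one.\<close>
definition obs :: "nat \<Rightarrow> (nat set \<Rightarrow> real) \<Rightarrow> uss_state \<Rightarrow> real" where
  "obs t f s = f (lab s) - (m / t) * corr t f s"

lemma lab_msets: "lab s \<in> msets"
  by (simp add: lab_def msets_def)

lemma risk_nonneg: "risk t s \<ge> 0"
  using absdev_nonneg by (simp add: risk_def)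

lemma E_absdev: assumes "t \<ge> 1" shows "E t (absdev t) \<le> m * sqrt t"
proof -
  have s0: "sqrt t > 0" using assms by simp
  have "E t (absdev t) \<le> E t (\<lambda>s. (sqdev t s / sqrt t + m * sqrt t) / 2)"
  proof (intro E_mono absdev_integrable)
    show "integrable (measure_pmf (uss_dist m D t)) (\<lambda>s. (sqdev t s / sqrt t + m * sqrt t) / 2)"
      using sqdev_integrable by simp
    fix s
    have "absdev t s \<le> (\<Sum>k<m. ((dev t s k)\<^sup>2 / sqrt t + sqrt t) / 2)"
      unfolding absdev_def
    proof (rule sum_mono)
      fix k
      \<comment> \<open>Arithmetic-geometric mean inequality with scale \<open>sqrt t\<close>,
        matched to the second moment bound \<open>E t (sqdev t) <= t\<close>.\<close>
      have "2 * \<bar>dev t s k\<bar> * sqrt t \<le> (dev t s k)\<^sup>2 + (sqrt t)\<^sup>2"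
        using zero_le_power2[of "\<bar>dev t s k\<bar> - sqrt t"] by (simp add: power2_diff)
      then show "\<bar>dev t s k\<bar> \<le> ((dev t s k)\<^sup>2 / sqrt t + sqrt t) / 2"
        using s0 by (simp add: field_simps power2_eq_square)
    qed
    also have "\<dots> = (sqdev t s / sqrt t + m * sqrt t) / 2"
      by (simp add: sqdev_def sum.distrib flip: sum_divide_distrib)
    finally show "absdev t s \<le> (sqdev t s / sqrt t + m * sqrt t) / 2" .
  qed
  also have "\<dots> = (E t (sqdev t) / sqrt t + m * sqrt t) / 2"
    using sqdev_integrable by simp
  also have "\<dots> \<le> (t / sqrt t + m * sqrt t) / 2"
    using E_sqdev[of t] s0 by (intro divide_right_mono add_right_mono) auto
  also have "real t / sqrt t = sqrt t" by (simp add: real_div_sqrt)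
  also have "(sqrt t + m * sqrt t) / 2 \<le> m * sqrt t"
  proof -
    have "1 * sqrt t \<le> m * sqrt t" by (rule mult_right_mono) (use m_pos in auto)
    then show ?thesis by simp
  qed
  finally show ?thesis .
qed

text \<open>If the minimal count is at least about \<open>t / (2 * m)\<close>, the first term
  suffices. Otherwise that bin deviates by \<open>t / (2 * m)\<close>, so
  \<open>16 * m^4 * sqdev^2 / t^4 >= 1\<close>, and this multiplies the crude bound
  \<open>m * t + 1\<close>: Markov's inequality in pointwise form.\<close>

lemma risk_le:
  assumes tot: "total t s" and t: "t \<ge> 1"
  shows "risk t s \<le> (2 * real m / real t) * (absdev t s + 1) + (16 * real m ^ 4 * (real m * real t + 1) / real t ^ 4) * (sqdev t s)\<^sup>2"
proof -
  define N where "N = mincount (snd s)"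
  have tp: "real t > 0" "real m > 0" using t m_pos by auto
  have a0: "absdev t s \<ge> 0" by (rule absdev_nonneg)
  have pos2: "(16 * real m ^ 4 * (real m * real t + 1) / real t ^ 4) * (sqdev t s)\<^sup>2 \<ge> 0" by simp
  show ?thesis
  proof (cases "real N + 1 < real t / (2 * real m)")
    case False
    then have ge: "real t / (2 * real m) \<le> real N + 1" by simp
    have "risk t s \<le> (absdev t s + 1) / (real t / (2 * real m))"
      unfolding risk_def N_def[symmetric] by (rule divide_left_mono[OF ge]) (use a0 tp in auto)
    also have "\<dots> = (2 * real m / real t) * (absdev t s + 1)" by simp
    finally show ?thesis using pos2 by linarith
  next
    case True
    obtain k where k: "k < m" "snd s k = N"
      using minbins_ne[of "snd s"] by (auto simp: minbins_def N_def)
    have "real t / (2 * real m) \<le> - dev t s k"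
      using True k by (simp add: dev_def field_simps)
    then have "(real t / (2 * real m))\<^sup>2 \<le> (- dev t s k)\<^sup>2"
      by (rule power_mono) simp
    also have "\<dots> \<le> sqdev t s" using dev_sqdev[OF k(1)] by simp
    finally have "((real t / (2 * real m))\<^sup>2)\<^sup>2 \<le> (sqdev t s)\<^sup>2"
      by (rule power_mono) simp
    moreover have "((real t / (2 * real m))\<^sup>2)\<^sup>2 = real t ^ 4 / (16 * real m ^ 4)"
      by (simp add: power_divide power_mult_distrib flip: power_mult)
    ultimately have "real t ^ 4 / (16 * real m ^ 4) \<le> (sqdev t s)\<^sup>2" by simp
    then have one: "1 \<le> 16 * real m ^ 4 / real t ^ 4 * (sqdev t s)\<^sup>2"
      using tp by (simp add: field_simps)
    have "risk t s \<le> (absdev t s + 1) / 1"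
      unfolding risk_def by (rule divide_left_mono) (use a0 in auto)
    also have "\<dots> \<le> (real m * real t + 1) * 1" using absdev_le[OF tot] by simp
    also have "\<dots> \<le> (real m * real t + 1) * (16 * real m ^ 4 / real t ^ 4 * (sqdev t s)\<^sup>2)"
      using one by (intro mult_left_mono) auto
    also have "\<dots> = (16 * real m ^ 4 * (real m * real t + 1) / real t ^ 4) * (sqdev t s)\<^sup>2" by simp
    finally show ?thesis using a0 tp by (simp add: add_increasing)
  qed
qed

lemma risk_le_linear: "total t s \<Longrightarrow> risk t s \<le> real m * real t + 1"
proof -
  assume "total t s"
  have "risk t s \<le> (absdev t s + 1) / 1"
    unfolding risk_def by (rule divide_left_mono) (use absdev_nonneg in auto)
  then show ?thesis using absdev_le[OF \<open>total t s\<close>] by simp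
qed

lemma risk_integrable: "integrable (measure_pmf (uss_dist m D t)) (risk t)"
  by (rule integrable_total[where B = "real m * real t + 1"])
     (simp add: risk_le_linear risk_nonneg del: of_nat_mult of_nat_add)

lemma E_risk: assumes t: "t \<ge> 1" shows "E t (risk t) \<le> (4 * real m ^ 2 + 224 * real m ^ 5) / sqrt t"
proof -
  have s0: "sqrt t \<ge> 1" using t by simp
  have m1: "real m \<ge> 1" using m_pos by simp
  have st: "sqrt t * sqrt t = t" by simp
  note i = absdev_integrable[of t] sqdev2_integrable[of t]
  have "E t (risk t) \<le> E t (\<lambda>s. (2 * real m / real t) * (absdev t s + 1) + (16 * real m ^ 4 * (real m * real t + 1) / real t ^ 4) * (sqdev t s)\<^sup>2)"
  proof (rule E_mono[OF risk_integrable])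
    show "integrable (measure_pmf (uss_dist m D t)) (\<lambda>s. (2 * real m / real t) * (absdev t s + 1) + (16 * real m ^ 4 * (real m * real t + 1) / real t ^ 4) * (sqdev t s)\<^sup>2)"
      by (intro Bochner_Integration.integrable_add integrable_mult_right i) simp
    fix s assume "valid t s"
    then show "risk t s \<le> (2 * real m / real t) * (absdev t s + 1) + (16 * real m ^ 4 * (real m * real t + 1) / real t ^ 4) * (sqdev t s)\<^sup>2"
      using risk_le t by (simp only: valid_def)
  qed
  also have "\<dots> = (2 * real m / real t) * (E t (absdev t) + 1) + (16 * real m ^ 4 * (real m * real t + 1) / real t ^ 4) * E t (\<lambda>s. (sqdev t s)\<^sup>2)"
    by (subst Bochner_Integration.integral_add, intro integrable_mult_right Bochner_Integration.integrable_add i, simp,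
        intro integrable_mult_right i, subst integral_mult_right_zero, subst integral_mult_right_zero,
        subst Bochner_Integration.integral_add, rule i, simp) simp
  also have "\<dots> \<le> (2 * real m / real t) * (m * sqrt t + 1) + (16 * real m ^ 4 * (real m * real t + 1) / real t ^ 4) * (7 * (real t)\<^sup>2)"
    using E_absdev[OF t] E_sqdev2[of t] by (intro add_mono mult_left_mono) auto
  also have "(2 * real m / real t) * (m * sqrt t + 1) \<le> 4 * real m ^ 2 / sqrt t"
  proof -
    have "1 * 1 \<le> m * sqrt t" using m1 s0 by (intro mult_mono) auto
    then have "(2 * real m / real t) * (m * sqrt t + 1) \<le> (2 * real m / real t) * (2 * (m * sqrt t))"
      by (intro mult_left_mono) auto
    also have "\<dots> = 4 * real m ^ 2 / sqrt t" using t st s0 by (simp add: field_simps power2_eq_square)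
    finally show ?thesis .
  qed
  \<comment> \<open>The constant is \<open>16 * 7 * 2\<close>: from the pointwise bound, from the
    fourth moment, and from \<open>m * t + 1 <= 2 * m * t\<close>.\<close>
  also have "(16 * real m ^ 4 * (real m * real t + 1) / real t ^ 4) * (7 * (real t)\<^sup>2) \<le> 224 * real m ^ 5 / sqrt t"
  proof -
    have tp: "real t > 0" using t by simp
    have "(16 * real m ^ 4 * (real m * real t + 1) / real t ^ 4) * (7 * (real t)\<^sup>2) = 112 * real m ^ 4 * (real m * real t + 1) / real t ^ 2"
      using tp by (simp add: field_simps power2_eq_square power4_eq_xxxx)
    also have "\<dots> \<le> 112 * real m ^ 4 * (2 * (real m * real t)) / real t ^ 2"
    proof -
      have "1 * 1 \<le> m * real t" using m1 t by (intro mult_mono) auto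
      then show ?thesis by (intro divide_right_mono mult_left_mono) auto
    qed
    also have "\<dots> = 224 * real m ^ 5 / t" using tp by (simp add: field_simps power2_eq_square eval_nat_numeral)
    also have "\<dots> \<le> 224 * real m ^ 5 / sqrt t"
    proof (rule divide_left_mono)
      have "sqrt t * 1 \<le> sqrt t * sqrt t" using s0 by (intro mult_left_mono) auto
      then show "sqrt t \<le> t" using st by simp
    qed (use s0 tp in auto)
    finally show ?thesis .
  qed
  finally show ?thesis by (simp add: add_divide_distrib)
qed

section \<open>Fully labelled states and the size of the corrector\<close>

lemma finite_labels: "finite (uss_labels m s)"
proof -
  have "uss_labels m s \<subseteq> (\<lambda>k. the (fst s k)) ` {..<m}" by (force simp: uss_labels_def)
  then show ?thesis using finite_surj by blast
qed

text \<open>By counting: \<open>m\<close> distinct labels in \<open>m\<close> bins leave no bin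
  unlabelled, so \<open>the\<close> is meaningful for every \<open>k < m\<close>.\<close>

lemma label_in:
  assumes "uss_labels m s \<in> msets" "k < m"
  shows "fst s k = Some (the (fst s k)) \<and> the (fst s k) \<in> uss_labels m s"
proof -
  let ?J = "{j. j < m \<and> fst s j \<noteq> None}"
  have "uss_labels m s \<subseteq> (\<lambda>k. the (fst s k)) ` ?J" by (force simp: uss_labels_def)
  then have "card (uss_labels m s) \<le> card ((\<lambda>k. the (fst s k)) ` ?J)" by (intro card_mono) auto
  also have "\<dots> \<le> card ?J" by (rule card_image_le) simp
  finally have "card {..<m} \<le> card ?J" using assms(1) by (simp add: msets_def)
  moreover have "?J \<subseteq> {..<m}" by auto
  ultimately have "?J = {..<m}" using card_subset_eq[of "{..<m}" ?J] card_mono[of "{..<m}" ?J] by simp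
  then obtain x where "fst s k = Some x" using assms(2) by auto
  then show ?thesis using assms(2) by (auto simp: uss_labels_def)
qed

lemma labels_eq: "uss_labels m s \<in> msets \<Longrightarrow> uss_labels m s = (\<lambda>k. the (fst s k)) ` {..<m}"
  using label_in[of s] by (force simp: uss_labels_def)

lemma full_labels:
  assumes i: "valid t s" and pos: "mincount (snd s) > 0"
  shows "uss_labels m s \<in> msets"
proof -
  have some: "\<exists>x. fst s k = Some x" if "k < m" for k
    using i pos mincount_le[OF that, of "snd s"] that by (cases "fst s k") (auto simp: valid_def)
  have "inj_on (\<lambda>k. the (fst s k)) {..<m}"
    using i some by (intro inj_onI) (auto simp: valid_def, metis option.sel)
  then have "card ((\<lambda>k. the (fst s k)) ` {..<m}) = m" by (simp add: card_image)
  moreover have "uss_labels m s = (\<lambda>k. the (fst s k)) ` {..<m}"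
    using some by (force simp: uss_labels_def)
  ultimately show ?thesis using finite_labels[of s] by (simp add: msets_def)
qed

lemma ratio_le:
  assumes "bdd f b" "S \<in> msets" "a \<in> S"
  shows "\<bar>jump f S a / (1 - P S)\<bar> \<le> 2 * b / gam"
proof -
  have "\<bar>jump f S a\<bar> / (1 - P S) \<le> 2 * b / gam"
    using jump_abs_le[OF assms] P_le[OF assms(2)] gam_pos by (intro frac_le) auto
  moreover have "1 - P S > 0" using P_le[OF assms(2)] gam_pos by linarith
  ultimately show ?thesis by simp
qed

lemma corr_abs_le:
  assumes "bdd f b"
  shows "\<bar>corr t f s\<bar> \<le> 2 * b / gam * absdev t s"
proof (cases "uss_labels m s \<in> msets")
  case True
  have "\<bar>corr t f s\<bar> \<le> (\<Sum>k<m. \<bar>dev t s k * (jump f (uss_labels m s) (the (fst s k)) / (1 - P (uss_labels m s)))\<bar>)"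
    unfolding corr_def using True by (simp del: times_divide_eq_right abs_divide)
  also have "\<dots> \<le> (\<Sum>k<m. \<bar>dev t s k\<bar> * (2 * b / gam))"
    unfolding abs_mult by (intro sum_mono mult_left_mono ratio_le[OF assms True]) (use label_in[OF True] in auto)
  finally show ?thesis by (simp only: absdev_def mult.commute flip: sum_distrib_right)
next
  case False
  then show ?thesis using absdev_nonneg bdd_nonneg[OF assms] gam_pos by (simp add: corr_def)
qed

lemma absdev_bump:
  assumes "k < m"
  shows "absdev (Suc t) (L', bump C k) \<le> absdev t (L, C) + 2"
proof -
  have "absdev (Suc t) (L', bump C k) \<le> (\<Sum>j<m. \<bar>dev t (L, C) j\<bar> + (1 / m + (if j = k then 1 else 0)))"
    unfolding absdev_def dev_bump[where L = L]
  proof (rule sum_mono)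
    fix j
    have abs3: "0 \<le> c \<Longrightarrow> 0 \<le> d \<Longrightarrow> \<bar>z - c + d\<bar> \<le> \<bar>z\<bar> + (c + d)" for z c d :: real
      by linarith
    show "\<bar>dev t (L, C) j - 1 / m + (if j = k then 1 else 0)\<bar> \<le> \<bar>dev t (L, C) j\<bar> + (1 / m + (if j = k then 1 else 0))"
      by (rule abs3) simp_all
  qed
  also have "\<dots> = absdev t (L, C) + 2"
    using assms m_pos by (simp add: sum.distrib absdev_def)
  finally show ?thesis .
qed

lemma next_state_cases:
  assumes i: "valid t (L, C)" and s': "s' \<in> set_pmf (next_state (L, C))"
  shows "\<exists>L' k. k < m \<and> s' = (L', bump C k)"
proof -
  obtain x where x: "s' \<in> set_pmf (uss_step m (L, C) x)" using s' by (auto simp: next_state_def)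
  show ?thesis
  proof (cases "x \<in> uss_labels m (L, C)")
    case True
    then obtain j where j: "j < m" "L j = Some x" by (auto simp: uss_labels_def)
    then show ?thesis using step_hit[OF i j] x by auto
  next
    case False
    then show ?thesis using x minbins_finite minbins_ne unfolding step_miss[OF False] by (auto simp: minbins_def)
  qed
qed

section \<open>One-step drift of the corrected observable\<close>

lemma obs_abs_le:
  assumes "bdd f b" 
  shows "\<bar>obs t f s\<bar> \<le> b + (m / t) * (2 * b / gam * absdev t s)"
proof -
  have "\<bar>obs t f s\<bar> \<le> \<bar>f (lab s)\<bar> + \<bar>(m / t) * corr t f s\<bar>" unfolding obs_def by (rule abs_triangle_ineq4)
  also have "\<bar>(m / t) * corr t f s\<bar> = (m / t) * \<bar>corr t f s\<bar>" by (simp add: abs_mult)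
  also have "\<bar>f (lab s)\<bar> \<le> b" using assms lab_msets by (simp add: bdd_def)
  also have "(m / t) * \<bar>corr t f s\<bar> \<le> (m / t) * (2 * b / gam * absdev t s)"
    using corr_abs_le[OF assms] by (intro mult_left_mono) auto
  finally show ?thesis by simp
qed

lemma obs_bounded:
  assumes "bdd f b" "total t s"
  shows "\<bar>obs t f s\<bar> \<le> b + (m / t) * (2 * b / gam * (m * t))"
proof -
  have "(m / t) * (2 * b / gam * absdev t s) \<le> (m / t) * (2 * b / gam * (m * t))"
    using absdev_le[OF assms(2)] bdd_nonneg[OF assms(1)] gam_pos by (intro mult_left_mono) auto
  then show ?thesis using obs_abs_le[OF assms(1), of t s] by linarith
qed

lemma obs_integrable: "bdd f b \<Longrightarrow> integrable (measure_pmf (uss_dist m D t)) (obs t f)"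
  by (rule integrable_total) (rule obs_bounded)

text \<open>A bin of count \<open>0\<close> deviates by \<open>t / m\<close>, so
  \<open>m * risk / t >= 1\<close>. The right-hand side is then large enough for the three terms to
  be bounded separately, without any cancellation.\<close>

lemma one_step_empty:
  assumes i: "valid t (L, C)" and t: "t \<ge> 1" and b: "bdd f b" and N0: "mincount C = 0"
  shows "\<bar>measure_pmf.expectation (next_state (L, C)) (obs (Suc t) f) - obs t f (L, C) - gen f (lab (L, C)) / t\<bar>
     \<le> 4 * real m * (1 + 2 / gam) * b * (risk t (L, C) / t)"
proof -
  define A where "A = absdev t (L, C)"
  define K where "K = 2 / gam"
  have K: "K \<ge> 0" using gam_pos by (simp add: K_def)
  have b0: "b \<ge> 0" by (rule bdd_nonneg[OF b])
  have A0: "A \<ge> 0" by (simp add: A_def absdev_nonneg)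
  have tp: "real t > 0" using t by simp
  have r: "risk t (L, C) = A + 1" by (simp add: risk_def A_def N0)
  obtain k where k: "k < m" "C k = 0" using minbins_ne[of C] N0 by (auto simp: minbins_def)
  have "t / m \<le> A" using abs_dev_absdev[OF k(1), of t "(L, C)"] k by (simp add: dev_def A_def)
  then have one: "1 \<le> m * (A + 1) / t" using m_pos tp by (simp add: field_simps)
  have e1: "\<bar>measure_pmf.expectation (next_state (L, C)) (obs (Suc t) f)\<bar> \<le> b + (m / t) * (K * b * (A + 2))"
  proof (rule integral_pmf_abs_le)
    fix s' assume "s' \<in> set_pmf (next_state (L, C))"
    then obtain L' k where s': "k < m" "s' = (L', bump C k)" using next_state_cases[OF i] by blast
    have "\<bar>obs (Suc t) f s'\<bar> \<le> b + (m / Suc t) * (2 * b / gam * absdev (Suc t) s')"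
      by (rule obs_abs_le[OF b])
    also have "\<dots> \<le> b + (m / t) * (2 * b / gam * (A + 2))"
      using absdev_bump[OF s'(1), of t L' C L] b0 gam_pos absdev_nonneg tp
      by (intro add_left_mono mult_mono divide_left_mono) (auto simp: A_def s'(2))
    finally show "\<bar>obs (Suc t) f s'\<bar> \<le> b + (m / t) * (K * b * (A + 2))" by (simp add: K_def)
  qed
  have e2: "\<bar>obs t f (L, C)\<bar> \<le> b + (m / t) * (K * b * A)"
    using obs_abs_le[OF b, of t "(L, C)"] by (simp add: K_def A_def)
  have e3: "\<bar>gen f (lab (L, C)) / t\<bar> \<le> 2 * real m * b / t"
    using gen_bdd[OF b] lab_msets tp by (auto simp: bdd_def intro!: divide_right_mono)
  have "\<bar>measure_pmf.expectation (next_state (L, C)) (obs (Suc t) f) - obs t f (L, C) - gen f (lab (L, C)) / t\<bar>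
     \<le> 2 * b * 1 + (m / t) * (K * b * (2 * A + 2)) + 2 * real m * b / t"
  proof -
    have "\<bar>measure_pmf.expectation (next_state (L, C)) (obs (Suc t) f) - obs t f (L, C) - gen f (lab (L, C)) / t\<bar>
      \<le> (b + (m / t) * (K * b * (A + 2))) + (b + (m / t) * (K * b * A)) + 2 * real m * b / t"
      using e1 e2 e3 by linarith
    also have "\<dots> = 2 * b * 1 + (m / t) * (K * b * (2 * A + 2)) + 2 * real m * b / t"
      by (simp add: distrib_left)
    finally show ?thesis .
  qed
  also have "\<dots> \<le> 2 * b * (m * (A + 1) / t) + (m / t) * (K * b * (4 * (A + 1))) + 2 * real m * b * (A + 1) / t"
  proof (intro add_mono mult_left_mono one divide_right_mono)
    show "2 * real m * b \<le> 2 * real m * b * (A + 1)" using A0 b0 using mult_left_mono[of 1 "A + 1" "2 * real m * b"] by simp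
  qed (use A0 b0 K tp in auto)
  also have "\<dots> = 4 * real m * (1 + 2 / gam) * b * (risk t (L, C) / t)"
    unfolding r K_def[symmetric] using tp by (simp add: field_simps)
  finally show ?thesis .
qed

text \<open>The drift is computed exactly in \<open>main\<close>. Four errors remain: the change of
  the weight \<open>m / t\<close>, the mismatch of \<open>1 / (N + 1)\<close> and
  \<open>m / T\<close>, the change from \<open>1 / t\<close> to \<open>1 / T\<close> at
  \<open>gen\<close>, and the effect of relabelling on the corrector itself.\<close>

lemma one_step_full:
  assumes i: "valid t (L, C)" and t: "t \<ge> 1" and b: "bdd f b" and N1: "mincount C > 0"
  shows "\<bar>measure_pmf.expectation (next_state (L, C)) (obs (Suc t) f) - obs t f (L, C) - gen f (lab (L, C)) / t\<bar>
     \<le> 4 * real m * (1 + 2 / gam) * b * (risk t (L, C) / t + (absdev t (L, C) + 1) / (real t)\<^sup>2)"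
proof -
  define A where "A = absdev t (L, C)"
  define K where "K = 2 / gam"
  define N where "N = real (mincount C)"
  define S where "S = uss_labels m (L, C)"
  define q where "q = (\<lambda>k. the (L k))"
  define h where "h = (\<lambda>k. jump f S (q k))"
  define g where "g = (\<lambda>k. jump f S (q k) / (1 - P S))"
  define T where "T = real t + 1"
  have K: "K \<ge> 2" using gam_pos gam_le by (simp add: K_def field_simps)
  have b0: "b \<ge> 0" by (rule bdd_nonneg[OF b])
  have A0: "A \<ge> 0" by (simp add: A_def absdev_nonneg)
  have tp: "real t > 0" using t by simp
  have Np: "N > 0" using N1 by (simp add: N_def)
  have S: "S \<in> msets" using full_labels[OF i] N1 by (simp add: S_def)
  have P1: "1 - P S > 0" using P_le[OF S] gam_pos by linarith
  have qS: "L k = Some (q k)" "q k \<in> S" if "k < m" for k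
    using label_in[of "(L, C)" k] S that by (auto simp: S_def q_def)
  have qinj: "inj_on q {..<m}"
  proof (rule inj_onI)
    fix x y assume xy: "x \<in> {..<m}" "y \<in> {..<m}" "q x = q y"
    then have "L x = Some (q x)" "L y = Some (q x)" using qS(1)[of x] qS(1)[of y] by auto
    then show "x = y" using i xy(1,2) unfolding valid_def fst_conv by blast
  qed
  have qimg: "S = q ` {..<m}" using labels_eq[of "(L, C)"] S by (simp add: S_def q_def)
  have labS: "lab (L, C) = S" using S by (simp add: lab_def S_def)
  have gen_eq: "gen f S = (\<Sum>k<m. g k) - m * (\<Sum>k<m. lprob L k * g k)"
  proof -
    have "gen f S = (\<Sum>a\<in>q ` {..<m}. (1 - m * pmf D a) * (jump f S a / (1 - P S)))"
      unfolding gen_def using qimg by simp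
    also have "\<dots> = (\<Sum>k<m. (1 - m * pmf D (q k)) * g k)"
      by (subst sum.reindex[OF qinj]) (simp add: g_def)
    also have "\<dots> = (\<Sum>k<m. g k - m * (lprob L k * g k))"
    proof (rule sum.cong)
      fix k assume "k \<in> {..<m}"
      then have "lprob L k = pmf D (q k)" using qS by (simp add: lprob_def measure_pmf_single eq_commute)
      then show "(1 - m * pmf D (q k)) * g k = g k - m * (lprob L k * g k)" by (simp add: left_diff_distrib)
    qed simp
    finally show ?thesis by (simp add: sum_subtractf sum_distrib_left)
  qed
  define \<psi> where "\<psi> = corr t f (L, C)"
  have psi: "\<psi> = (\<Sum>j<m. dev t (L, C) j * g j)"
    using S by (simp add: \<psi>_def corr_def S_def g_def q_def)
  have labels_bump: "uss_labels m (L', bump C k) = uss_labels m (L', C)" for L' k by (simp add: uss_labels_def)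
  have corr_bump: "corr (Suc t) f (L, bump C k) = \<psi> - (1 / m) * (\<Sum>j<m. g j) + g k" if k: "k < m" for k
  proof -
    have "corr (Suc t) f (L, bump C k) = (\<Sum>j<m. (dev t (L, C) j - 1 / m + (if j = k then 1 else 0)) * g j)"
      unfolding corr_def labels_bump dev_bump[where L = L] using S by (simp add: S_def g_def q_def)
    also have "\<dots> = (\<Sum>j<m. dev t (L, C) j * g j - (1 / m) * g j + (if j = k then g j else 0))"
      by (rule sum.cong) (auto simp: algebra_simps)
    also have "\<dots> = \<psi> - (1 / m) * (\<Sum>j<m. g j) + g k"
      using k by (simp add: sum.distrib sum_subtractf psi sum_distrib_left)
    finally show ?thesis .
  qed
  define H where "H = (\<Sum>k<m. minprob C k * h k)"
  have incg: "(\<Sum>k<m. incprob L C k * g k) = (\<Sum>k<m. lprob L k * g k) + H"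
  proof -
    have "(\<Sum>k<m. incprob L C k * g k) = (\<Sum>k<m. lprob L k * g k + minprob C k * h k)"
    proof (rule sum.cong)
      fix k
      have "(1 - P S) * g k = h k" using P1 by (simp add: g_def h_def)
      then show "incprob L C k * g k = lprob L k * g k + minprob C k * h k"
        unfolding incprob_def S_def[symmetric] by (metis distrib_right mult.assoc mult.commute)
    qed simp
    then show ?thesis by (simp add: sum.distrib H_def)
  qed
  \<comment> \<open>\<open>H\<close> is the mean effect of relabelling the bin that is minimal now,
    \<open>gen f S / m\<close> its long-run value. The drift of \<open>corr\<close> is exactly their
    difference, since \<open>dev\<close> at bin \<open>k\<close> drifts by
    \<open>incprob L C k - 1 / m\<close>.\<close>
  have part1: "(\<Sum>k<m. incprob L C k * obs (Suc t) f (L, bump C k)) = f S - (m / T) * (\<psi> + H - gen f S / m)"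
  proof -
    have "(\<Sum>k<m. incprob L C k * obs (Suc t) f (L, bump C k)) =
        (\<Sum>k<m. incprob L C k * (f S - (m / T) * (\<psi> - (1 / m) * (\<Sum>j<m. g j))) - (m / T) * (incprob L C k * g k))"
    proof (rule sum.cong)
      fix k assume "k \<in> {..<m}"
      then have "obs (Suc t) f (L, bump C k) = (f S - (m / T) * (\<psi> - (1 / m) * (\<Sum>j<m. g j))) - (m / T) * g k"
        using S corr_bump[of k] by (simp add: obs_def lab_def labels_bump S_def[symmetric] T_def distrib_left add.commute)
      then show "incprob L C k * obs (Suc t) f (L, bump C k) =
          incprob L C k * (f S - (m / T) * (\<psi> - (1 / m) * (\<Sum>j<m. g j))) - (m / T) * (incprob L C k * g k)"
        by (simp only: right_diff_distrib mult.left_commute)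
    qed simp
    also have "\<dots> = (f S - (m / T) * (\<psi> - (1 / m) * (\<Sum>j<m. g j))) - (m / T) * ((\<Sum>k<m. lprob L k * g k) + H)"
      unfolding sum_subtractf sum_distrib_left[symmetric] sum_distrib_right[symmetric] sum_incprob[OF i] incg by simp
    also have "\<dots> = f S - (m / T) * (\<psi> + H - gen f S / m)"
      using m_pos unfolding gen_eq by (simp add: diff_divide_distrib distrib_left right_diff_distrib)
    finally show ?thesis .
  qed
  \<comment> \<open>The corrector also depends on the labels. Its jump may be as large as
    \<open>absdev\<close>, but it enters with the factor \<open>m / T\<close> times the relabelling
    probability.\<close>
  define e where "e = (\<lambda>k. measure_pmf.expectation D (\<lambda>x. if x \<in> S then 0 else corr (Suc t) f (L(k := Some x), bump C k) - corr (Suc t) f (L, bump C k)))"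
  have corrb: "\<bar>corr (Suc t) f (L', bump C k)\<bar> \<le> K * b * (A + 2)" if "k < m" for L' k
  proof -
    have "\<bar>corr (Suc t) f (L', bump C k)\<bar> \<le> 2 * b / gam * absdev (Suc t) (L', bump C k)"
      by (rule corr_abs_le[OF b])
    also have "\<dots> \<le> 2 * b / gam * (A + 2)"
      using absdev_bump[OF that, of t L' C L] b0 gam_pos by (intro mult_left_mono) (auto simp: A_def)
    finally show ?thesis by (simp add: K_def)
  qed
  have KbA: "K * b * (A + 2) \<ge> 0" using K b0 A0 by simp
  have cdb: "\<bar>if x \<in> S then 0 else corr (Suc t) f (L(k := Some x), bump C k) - corr (Suc t) f (L, bump C k)\<bar> \<le> 2 * (K * b * (A + 2))"
    if "k < m" for k x
    using corrb[OF that, of "L(k := Some x)"] corrb[OF that, of L] KbA by auto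
  have eb: "\<bar>e k\<bar> \<le> 2 * (K * b * (A + 2))" if "k < m" for k
    unfolding e_def by (rule integral_pmf_abs_le) (rule cdb[OF that])
  have part2: "measure_pmf.expectation D (\<lambda>x. if x \<in> S then 0 else obs (Suc t) f (L(k := Some x), bump C k) - obs (Suc t) f (L, bump C k))
     = h k - (m / T) * e k" if k: "k < m" for k
  proof -
    let ?j = "\<lambda>x. if x \<in> S then 0 else f (insert x (S - {q k})) - f S"
    let ?c = "\<lambda>x. if x \<in> S then 0 else corr (Suc t) f (L(k := Some x), bump C k) - corr (Suc t) f (L, bump C k)"
    have lab: "uss_labels m (L(k := Some x), C) = insert x (S - {q k})" if "x \<notin> S" for x
    proof -
      have "uss_labels m (L(k := Some x), C) = insert x {y. \<exists>j<m. j \<noteq> k \<and> L j = Some y}"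
        using k by (auto simp: uss_labels_def)
      also have "{y. \<exists>j<m. j \<noteq> k \<and> L j = Some y} = S - {q k}"
        using qS qinj k by (auto simp: S_def uss_labels_def inj_on_def)
      finally show ?thesis .
    qed
    have "measure_pmf.expectation D (\<lambda>x. if x \<in> S then 0 else obs (Suc t) f (L(k := Some x), bump C k) - obs (Suc t) f (L, bump C k))
       = measure_pmf.expectation D (\<lambda>x. ?j x - (m / T) * ?c x)"
    proof (rule integral_pmf_cong)
      fix x
      have "insert x (S - {q k}) \<in> msets" if "x \<notin> S" using swap_msets[OF S qS(2)[OF k] that] .
      then show "(if x \<in> S then 0 else obs (Suc t) f (L(k := Some x), bump C k) - obs (Suc t) f (L, bump C k)) = ?j x - (m / T) * ?c x"
        using lab S by (auto simp: obs_def lab_def labels_bump S_def[symmetric] T_def add.commute right_diff_distrib diff_divide_distrib)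
    qed
    also have "\<dots> = measure_pmf.expectation D ?j - (m / T) * measure_pmf.expectation D ?c"
    proof -
      have "integrable (measure_pmf D) ?c" by (rule integrable_pmf_bounded) (rule cdb[OF k])
      then show ?thesis using jump_integrable[OF b S qS(2)[OF k]]
        by (subst Bochner_Integration.integral_diff) (simp_all only: integral_mult_right_zero integrable_mult_right)
    qed
    finally show ?thesis by (simp add: h_def e_def jump_def)
  qed
  define Er where "Er = (\<Sum>k<m. minprob C k * e k)"
  have "measure_pmf.expectation (next_state (L, C)) (obs (Suc t) f) = 
      (\<Sum>k<m. incprob L C k * obs (Suc t) f (L, bump C k)) +
      (\<Sum>k<m. minprob C k / (N + 1) * (h k - (m / T) * e k))"
    by (subst next_state_expectation[OF i], erule obs_bounded[OF b]) (simp add: part2 N_def S_def[symmetric])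
  also have "(\<Sum>k<m. minprob C k / (N + 1) * (h k - (m / T) * e k)) = (H - (m / T) * Er) / (N + 1)"
    by (simp add: H_def Er_def sum_distrib_left sum_subtractf[symmetric] sum_divide_distrib algebra_simps diff_divide_distrib)
  finally have ex: "measure_pmf.expectation (next_state (L, C)) (obs (Suc t) f) =
      (\<Sum>k<m. incprob L C k * obs (Suc t) f (L, bump C k)) + (H - (m / T) * Er) / (N + 1)" .
  \<comment> \<open>Relabelling contributes \<open>H / (N + 1)\<close> and the corrector subtracts
    \<open>(m / T) * H\<close>; these nearly cancel, and \<open>gen f S / T\<close> takes their
    place.\<close>
  have main: "measure_pmf.expectation (next_state (L, C)) (obs (Suc t) f) - obs t f (L, C) - gen f (lab (L, C)) / t =
      (m / t - m / T) * \<psi> + (1 / (N + 1) - m / T) * H + (1 / T - 1 / t) * gen f S - (m / T) * Er / (N + 1)"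
  proof -
    have "obs t f (L, C) = f S - (m / t) * \<psi>" by (simp add: obs_def labS \<psi>_def)
    then show ?thesis
      using m_pos unfolding ex part1 labS by (simp add: algebra_simps diff_divide_distrib add_divide_distrib)
  qed
  have wavg: "\<bar>\<Sum>k<m. minprob C k * y k\<bar> \<le> B" if "\<And>k. k < m \<Longrightarrow> \<bar>y k\<bar> \<le> B" for y B
  proof -
    have "\<bar>\<Sum>k<m. minprob C k * y k\<bar> \<le> (\<Sum>k<m. \<bar>minprob C k * y k\<bar>)" by (rule sum_abs)
    also have "\<dots> \<le> (\<Sum>k<m. minprob C k * B)"
      unfolding abs_mult using minprob_nonneg that by (intro sum_mono mult_mono) auto
    also have "\<dots> = B" using sum_minprob by (simp flip: sum_distrib_right)
    finally show ?thesis .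
  qed
  have Hb: "\<bar>H\<bar> \<le> 2 * b" unfolding H_def h_def
    by (rule wavg) (use jump_abs_le[OF b S] qS in auto)
  have Erb: "\<bar>Er\<bar> \<le> 2 * (K * b * (A + 2))" unfolding Er_def by (rule wavg) (rule eb)
  have psib: "\<bar>\<psi>\<bar> \<le> K * b * A" unfolding \<psi>_def K_def A_def using corr_abs_le[OF b, of t "(L, C)"] by simp
  have genb: "\<bar>gen f S\<bar> \<le> 2 * real m * b" using gen_bdd[OF b] S by (simp add: bdd_def)
  have r: "risk t (L, C) = (A + 1) / (N + 1)" by (simp add: risk_def A_def N_def)
  have Tt: "T > 0" "T \<ge> t" using tp by (auto simp: T_def)
  have invT: "\<bar>1 / T - 1 / t\<bar> \<le> 1 / (real t)\<^sup>2"
  proof -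
    have "1 / t - 1 / T = 1 / (t * T)" using tp Tt by (simp add: field_simps T_def)
    moreover have "1 / (t * T) \<le> 1 / (real t * t)" using tp Tt by (intro divide_left_mono mult_left_mono) auto
    moreover have "1 / (t * T) \<ge> 0" using tp Tt by simp
    ultimately show ?thesis
      unfolding power2_eq_square abs_minus_commute[of "1 / T"] by (simp only: abs_of_nonneg)
  qed
  have b1: "\<bar>(m / t - m / T) * \<psi>\<bar> \<le> m / (real t)\<^sup>2 * (K * b * (A + 1))"
  proof -
    have "\<bar>m / t - m / T\<bar> = m * \<bar>1 / T - 1 / t\<bar>"
      by (simp add: abs_minus_commute[of "1 / T"] flip: abs_mult[of "real m", simplified]) (simp add: right_diff_distrib)
    then have "\<bar>m / t - m / T\<bar> \<le> m * (1 / (real t)\<^sup>2)" using invT by (simp only: mult_left_mono of_nat_0_le_iff)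
    moreover have "\<bar>\<psi>\<bar> \<le> K * b * (A + 1)" using psib K b0 by (simp add: distrib_left add_increasing2)
    ultimately show ?thesis unfolding abs_mult using tp by (intro mult_mono) auto
  qed
  have b2: "\<bar>(1 / (N + 1) - m / T) * H\<bar> \<le> m / t * risk t (L, C) * (2 * b)"
  proof -
    \<comment> \<open>The minimum is attained at a bin, so \<open>absdev\<close> bounds its distance
      from \<open>t / m\<close>.\<close>
    obtain k where k: "k < m" "C k = mincount C" using minbins_ne[of C] by (auto simp: minbins_def)
    have d: "\<bar>t / m - N\<bar> \<le> A" using abs_dev_absdev[OF k(1), of t "(L, C)"] k by (simp add: dev_def A_def N_def abs_minus_commute)
    have shift: "\<bar>x + c - (N + 1)\<bar> \<le> A + 1" if "0 \<le> c" "c \<le> 1" "\<bar>x - N\<bar> \<le> A" for x c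
      using that by linarith
    have "\<bar>T / m - (N + 1)\<bar> \<le> A + 1"
      unfolding T_def add_divide_distrib by (rule shift[OF _ _ d]) (use m_pos in auto)
    then have "(m / T) * \<bar>T / m - (N + 1)\<bar> / (N + 1) \<le> (m / t) * (A + 1) / (N + 1)"
      using Np tp Tt by (intro divide_right_mono mult_mono divide_left_mono) auto
    moreover have "1 / (N + 1) - m / T = (m / T) * (T / m - (N + 1)) / (N + 1)"
    proof -
      have "(m / T) * (T / m - (N + 1)) = 1 - m / T * (N + 1)"
        unfolding right_diff_distrib using Tt m_pos by simp
      then show ?thesis using Np by (simp add: diff_divide_distrib)
    qed
    then have "\<bar>1 / (N + 1) - m / T\<bar> = (m / T) * \<bar>T / m - (N + 1)\<bar> / (N + 1)"
      using Np Tt by (simp add: abs_mult)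
    ultimately have "\<bar>1 / (N + 1) - m / T\<bar> \<le> m / t * risk t (L, C)" by (simp add: r)
    then show ?thesis unfolding abs_mult using Hb risk_nonneg by (intro mult_mono) auto
  qed
  have b3: "\<bar>(1 / T - 1 / t) * gen f S\<bar> \<le> 1 / (real t)\<^sup>2 * (2 * real m * b * (A + 1))"
  proof -
    have "2 * real m * b \<le> 2 * real m * b * (A + 1)" using A0 b0 using mult_left_mono[of 1 "A + 1" "2 * real m * b"] by simp
    then show ?thesis unfolding abs_mult using invT genb by (intro mult_mono) auto
  qed
  have b4: "\<bar>(m / T) * Er / (N + 1)\<bar> \<le> m / t * (4 * K * b * risk t (L, C))"
  proof -
    have "(m / T) * \<bar>Er\<bar> / (N + 1) \<le> (m / t) * (2 * (K * b * (2 * (A + 1)))) / (N + 1)"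
    proof (intro divide_right_mono mult_mono divide_left_mono order_trans[OF Erb] mult_left_mono)
    qed (use Np tp Tt K b0 A0 in auto)
    moreover have "\<bar>(m / T) * Er / (N + 1)\<bar> = (m / T) * \<bar>Er\<bar> / (N + 1)" using Np Tt by (simp add: abs_mult)
    ultimately show ?thesis by (simp add: r mult_ac)
  qed
  have "\<bar>measure_pmf.expectation (next_state (L, C)) (obs (Suc t) f) - obs t f (L, C) - gen f (lab (L, C)) / t\<bar>
     \<le> m / (real t)\<^sup>2 * (K * b * (A + 1)) + m / t * risk t (L, C) * (2 * b) + 1 / (real t)\<^sup>2 * (2 * real m * b * (A + 1)) + m / t * (4 * K * b * risk t (L, C))"
    unfolding main using b1 b2 b3 b4 by linarith
  also have "\<dots> = m * b * (K + 2) * ((A + 1) / (real t)\<^sup>2) + m * b * (2 + 4 * K) * (risk t (L, C) / t)"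
    using tp by (simp add: field_simps)
  also have "\<dots> \<le> m * b * (4 + 4 * K) * ((A + 1) / (real t)\<^sup>2) + m * b * (4 + 4 * K) * (risk t (L, C) / t)"
  proof -
    have "m * b * (K + 2) \<le> m * b * (4 + 4 * K)" "m * b * (2 + 4 * K) \<le> m * b * (4 + 4 * K)"
      by (rule mult_left_mono; use K b0 in simp)+
    then show ?thesis using A0 risk_nonneg[of t "(L, C)"] by (intro add_mono[OF mult_right_mono mult_right_mono]) auto
  qed
  also have "\<dots> = 4 * real m * (1 + 2 / gam) * b * (risk t (L, C) / t + (absdev t (L, C) + 1) / (real t)\<^sup>2)"
    unfolding K_def[symmetric] A_def[symmetric] by (simp add: algebra_simps)
  finally show ?thesis .
qed

lemma one_step:
  assumes i: "valid t s" and t: "t \<ge> 1" and b: "bdd f b"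
  shows "\<bar>measure_pmf.expectation (next_state s) (obs (Suc t) f) - obs t f s - gen f (lab s) / t\<bar>
     \<le> 4 * real m * (1 + 2 / gam) * b * (risk t s / t + (absdev t s + 1) / (real t)\<^sup>2)"
proof -
  obtain L C where s: "s = (L, C)" by fastforce
  show ?thesis
  proof (cases "mincount C = 0")
    case True
    have "0 \<le> 4 * real m * (1 + 2 / gam) * b * ((absdev t s + 1) / (real t)\<^sup>2)"
      using gam_pos bdd_nonneg[OF b] absdev_nonneg[of t s] by simp
    then show ?thesis using one_step_empty[OF i[unfolded s] t b True] unfolding s distrib_left by linarith
  next
    case False
    then show ?thesis using one_step_full[OF i[unfolded s] t b] unfolding s by simp
  qed
qed

lemma obs_linear:
  assumes "bdd f b" "bdd g b'"
  shows "obs t (\<lambda>S. f S + c * g S) s = obs t f s + c * obs t g s"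
proof (cases "uss_labels m s \<in> msets")
  case True
  have "corr t (\<lambda>S. f S + c * g S) s = (\<Sum>k<m. dev t s k * (jump f (uss_labels m s) (the (fst s k)) / (1 - P (uss_labels m s)))
     + c * (dev t s k * (jump g (uss_labels m s) (the (fst s k)) / (1 - P (uss_labels m s)))))"
    unfolding corr_def using True label_in[OF True]
    by (simp add: jump_linear[OF assms True] add_divide_distrib distrib_left mult.left_commute)
  also have "\<dots> = corr t f s + c * corr t g s"
    unfolding corr_def using True by (simp only: sum.distrib sum_distrib_left if_True)
  finally show ?thesis by (simp add: obs_def algebra_simps)
next
  case False
  then show ?thesis by (simp add: obs_def corr_def)
qed

section \<open>Recursion for the mean of the corrected observable\<close>

definition mean_obs :: "nat \<Rightarrow> (nat set \<Rightarrow> real) \<Rightarrow> real" where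
  "mean_obs t f = E t (obs t f)"

text \<open>The first summand averages the one-step error using the bounds on the means of
  \<open>risk\<close> and \<open>absdev\<close>. The second is the price of replacing
  \<open>gen f (lab s)\<close> by its corrected version, with the bound \<open>2 * m * b\<close> for
  \<open>gen f\<close>.\<close>

definition err :: real where
  "err = 4 * real m * (1 + 2 / gam) * (4 * real m ^ 2 + 224 * real m ^ 5 + 2 * real m) + 4 * real m ^ 3 / gam"

lemma err_nonneg: "err \<ge> 0" using gam_pos by (simp add: err_def)

lemma mean_obs_linear: "bdd f b \<Longrightarrow> bdd g b' \<Longrightarrow> mean_obs t (\<lambda>S. f S + c * g S) = mean_obs t f + c * mean_obs t g"
proof -
  assume a: "bdd f b" "bdd g b'"
  have "mean_obs t (\<lambda>S. f S + c * g S) = E t (\<lambda>s. obs t f s + c * obs t g s)"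
    unfolding mean_obs_def by (rule integral_pmf_cong) (rule obs_linear[OF a])
  then show ?thesis using obs_integrable[OF a(1)] obs_integrable[OF a(2)] by (simp add: mean_obs_def)
qed

lemma mean_obs_lab:
  assumes b: "bdd f b" and t: "t \<ge> 1"
  shows "\<bar>mean_obs t f - E t (\<lambda>s. f (lab s))\<bar> \<le> 2 * real m ^ 2 / gam * b / sqrt t"
proof -
  have b0: "b \<ge> 0" by (rule bdd_nonneg[OF b])
  have tp: "real t > 0" using t by simp
  have i1: "integrable (measure_pmf (uss_dist m D t)) (\<lambda>s. f (lab s))"
    by (rule integrable_pmf_bounded[where B = b]) (use b lab_msets in \<open>simp add: bdd_def\<close>)
  have i2: "integrable (measure_pmf (uss_dist m D t)) (corr t f)"
  proof (rule integrable_total)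
    fix s assume "total t s"
    then have "2 * b / gam * absdev t s \<le> 2 * b / gam * (m * t)"
      using absdev_le b0 gam_pos by (intro mult_left_mono) auto
    then show "\<bar>corr t f s\<bar> \<le> 2 * b / gam * (m * t)" using corr_abs_le[OF b, of t s] by linarith
  qed
  have "mean_obs t f - E t (\<lambda>s. f (lab s)) = - (m / t) * E t (corr t f)"
    unfolding mean_obs_def obs_def using i1 i2 by simp
  then have "\<bar>mean_obs t f - E t (\<lambda>s. f (lab s))\<bar> = (m / t) * \<bar>E t (corr t f)\<bar>" by (simp add: abs_mult)
  also have "\<dots> \<le> (m / t) * (2 * b / gam * (m * sqrt t))"
  proof (rule mult_left_mono)
    have "\<bar>E t (corr t f)\<bar> \<le> E t (\<lambda>s. \<bar>corr t f s\<bar>)" using integral_norm_bound[of _ "corr t f"] by simp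
    also have "\<dots> \<le> E t (\<lambda>s. 2 * b / gam * absdev t s)"
    proof (rule E_mono)
      show "integrable (measure_pmf (uss_dist m D t)) (\<lambda>s. 2 * b / gam * absdev t s)"
        by (intro integrable_mult_right absdev_integrable)
    qed (use i2 corr_abs_le[OF b] in auto)
    also have "\<dots> = 2 * b / gam * E t (absdev t)" by simp
    also have "\<dots> \<le> 2 * b / gam * (m * sqrt t)"
      using E_absdev[OF t] b0 gam_pos by (intro mult_left_mono) auto
    finally show "\<bar>E t (corr t f)\<bar> \<le> 2 * b / gam * (m * sqrt t)" .
  qed simp
  also have "\<dots> = 2 * real m ^ 2 / gam * b * (sqrt t / t)"
    by (simp add: power2_eq_square mult_ac)
  also have "sqrt t / t = 1 / sqrt t" using tp by (simp add: field_simps)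
  finally show ?thesis by simp
qed

lemma mean_obs_Suc_drift:
  assumes b: "bdd f b" and t: "t \<ge> 1"
  shows "\<bar>mean_obs (Suc t) f - mean_obs t f - E t (\<lambda>s. gen f (lab s)) / t\<bar>
    \<le> 4 * real m * (1 + 2 / gam) * b * (4 * real m ^ 2 + 224 * real m ^ 5 + 2 * real m) / (t * sqrt t)"
proof -
  define Q where "Q = 4 * real m * (1 + 2 / gam) * b"
  have b0: "b \<ge> 0" by (rule bdd_nonneg[OF b])
  have Q0: "Q \<ge> 0" unfolding Q_def using b0 gam_pos by simp
  have tp: "real t > 0" using t by simp
  have ig: "integrable (measure_pmf (uss_dist m D t)) (\<lambda>s. gen f (lab s))"
    by (rule integrable_pmf_bounded[where B = "2 * real m * b"]) (use gen_bdd[OF b] lab_msets in \<open>simp add: bdd_def\<close>)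
  have io: "integrable (measure_pmf (uss_dist m D t)) (obs t f)" by (rule obs_integrable[OF b])
  have isc: "integrable (measure_pmf (uss_dist m D t)) (\<lambda>s. measure_pmf.expectation (next_state s) (obs (Suc t) f))"
    by (rule next_state_integrable) (rule obs_bounded[OF b])
  define d where "d = (\<lambda>s. measure_pmf.expectation (next_state s) (obs (Suc t) f) - obs t f s - gen f (lab s) / t)"
  have id: "integrable (measure_pmf (uss_dist m D t)) d"
    unfolding d_def by (intro Bochner_Integration.integrable_diff isc io integrable_divide_zero ig)
  have "mean_obs (Suc t) f = E t (\<lambda>s. measure_pmf.expectation (next_state s) (obs (Suc t) f))"
    unfolding mean_obs_def by (rule expectation_Suc) (rule obs_bounded[OF b])
  then have "mean_obs (Suc t) f - mean_obs t f - E t (\<lambda>s. gen f (lab s)) / t = E t d"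
    unfolding d_def mean_obs_def using ig io isc by simp
  also have "\<bar>E t d\<bar> \<le> E t (\<lambda>s. \<bar>d s\<bar>)" using integral_norm_bound[of _ d] by simp
  also have "\<dots> \<le> E t (\<lambda>s. Q * (risk t s / t + (absdev t s + 1) / (real t)\<^sup>2))"
  proof (rule E_mono)
    show "integrable (measure_pmf (uss_dist m D t)) (\<lambda>s. Q * (risk t s / t + (absdev t s + 1) / (real t)\<^sup>2))"
      using risk_integrable absdev_integrable by simp
    fix s assume "valid t s"
    then show "\<bar>d s\<bar> \<le> Q * (risk t s / t + (absdev t s + 1) / (real t)\<^sup>2)"
      unfolding d_def Q_def by (rule one_step[OF _ t b])
  qed (use id in simp)
  also have "\<dots> = Q * (E t (risk t) / t + (E t (absdev t) + 1) / (real t)\<^sup>2)"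
    using risk_integrable[of t] absdev_integrable[of t] by simp
  also have "\<dots> \<le> Q * ((4 * real m ^ 2 + 224 * real m ^ 5) / (t * sqrt t) + 2 * real m / (t * sqrt t))"
  proof (intro mult_left_mono add_mono Q0)
    have "E t (risk t) / t \<le> (4 * real m ^ 2 + 224 * real m ^ 5) / sqrt t / t"
      using E_risk[OF t] by (intro divide_right_mono) auto
    then show "E t (risk t) / t \<le> (4 * real m ^ 2 + 224 * real m ^ 5) / (t * sqrt t)" by (simp add: mult.commute)
    have "1 * 1 \<le> m * sqrt t" using t m_pos by (intro mult_mono) auto
    then have "(E t (absdev t) + 1) / (real t)\<^sup>2 \<le> (2 * (m * sqrt t)) / (real t)\<^sup>2"
      using E_absdev[OF t] by (intro divide_right_mono) auto
    also have "\<dots> = 2 * m * (sqrt t / t) / t" by (simp add: power2_eq_square)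
    also have "sqrt t / t = 1 / sqrt t" using tp by (simp add: field_simps)
    finally show "(E t (absdev t) + 1) / (real t)\<^sup>2 \<le> 2 * real m / (t * sqrt t)" by (simp add: mult.commute)
  qed
  also have "\<dots> = Q * (4 * real m ^ 2 + 224 * real m ^ 5 + 2 * real m) / (t * sqrt t)"
    by (simp only: add_divide_distrib[symmetric] times_divide_eq_right)
  finally show ?thesis unfolding Q_def .
qed

text \<open>Closes the recursion: by linearity the main term is \<open>mean_obs t\<close> of
  \<open>f + gen f / t\<close>, the function that \<open>lip_contraction\<close> is about.\<close>

lemma mean_obs_Suc:
  assumes b: "bdd f b" and t: "t \<ge> 1"
  shows "\<bar>mean_obs (Suc t) f - (mean_obs t f + mean_obs t (gen f) / t)\<bar> \<le> err * b / (t * sqrt t)"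
proof -
  have tp: "real t > 0" using t by simp
  have "\<bar>mean_obs t (gen f) - E t (\<lambda>s. gen f (lab s))\<bar> / t \<le> 2 * real m ^ 2 / gam * (2 * real m * b) / sqrt t / t"
    using mean_obs_lab[OF gen_bdd[OF b] t] by (intro divide_right_mono) auto
  then have "\<bar>(mean_obs t (gen f) - E t (\<lambda>s. gen f (lab s))) / t\<bar> \<le> 4 * real m ^ 3 / gam * b / (t * sqrt t)"
    using tp by (simp add: power2_eq_square power3_eq_cube mult_ac)
  moreover have "err * b / (t * sqrt t) = 4 * real m * (1 + 2 / gam) * b * (4 * real m ^ 2 + 224 * real m ^ 5 + 2 * real m) / (t * sqrt t)
      + 4 * real m ^ 3 / gam * b / (t * sqrt t)"
    unfolding add_divide_distrib[symmetric] err_def distrib_right by (simp only: mult_ac)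
  moreover have "(mean_obs t (gen f) - E t (\<lambda>s. gen f (lab s))) / t = mean_obs t (gen f) / t - E t (\<lambda>s. gen f (lab s)) / t"
    by (rule diff_divide_distrib)
  ultimately show ?thesis using mean_obs_Suc_drift[OF b t] by linarith
qed

end

section \<open>Convergence\<close>

text \<open>The contraction \<open>2 * a / t\<close> is spent in two halves: one covers the passage
  from \<open>t\<close> to \<open>t + 1\<close> in the power, since
  \<open>1 - a / t <= (1 + 1 / t) powr (- a)\<close>; the other absorbs the error, using
  \<open>K <= A * a\<close> and \<open>a <= 1 / 2\<close>.\<close>

lemma powr_decay_step:
  fixes A K a t :: real
  assumes t: "t \<ge> 1" and a: "0 < a" "a \<le> 1 / 2" and A: "K \<le> A * a" "0 \<le> A" "0 \<le> K"
  shows "A * t powr (- a) * (1 - 2 * a / t) + K / (t * sqrt t) \<le> A * (t + 1) powr (- a)"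
proof -
  define y where "y = t powr (- a)"
  have y: "y > 0" using t by (simp add: y_def)
  have "1 - a / t \<le> (1 + 1 / t) powr (- a)"
  proof -
    have "ln (1 + 1 / t) \<le> 1 / t" by (rule ln_add_one_self_le_self) (use t in simp)
    then have "a * ln (1 + 1 / t) \<le> a * (1 / t)" using a by (intro mult_left_mono) auto
    then have "1 - a / t \<le> 1 + - a * ln (1 + 1 / t)" by simp
    also have "\<dots> \<le> exp (- a * ln (1 + 1 / t))" by (rule exp_ge_add_one_self)
    also have "\<dots> = (1 + 1 / t) powr (- a)"
    proof -
      have "1 + 1 / t \<noteq> 0" using t by (simp add: add_nonneg_eq_0_iff)
      then show ?thesis by (simp add: powr_def)
    qed
    finally show ?thesis .
  qed
  then have "y * (1 - a / t) \<le> y * (1 + 1 / t) powr (- a)" using y by simp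
  also have "\<dots> = (t + 1) powr (- a)"
  proof -
    have "t + 1 = t * (1 + 1 / t)" using t by (simp add: field_simps)
    then show ?thesis unfolding y_def using t by (metis add_nonneg_nonneg divide_nonneg_nonneg le_numeral_extra(1) order_trans powr_mult zero_le_one)
  qed
  finally have s1: "A * (y * (1 - a / t)) \<le> A * (t + 1) powr (- a)" using A by (intro mult_left_mono) auto
  have "1 / sqrt t = t powr (- (1 / 2))" using t by (simp add: powr_minus_divide powr_half_sqrt)
  also have "\<dots> \<le> y" unfolding y_def using t a by (intro powr_mono) auto
  finally have "1 / sqrt t \<le> y" .
  then have "K / t * (1 / sqrt t) \<le> A * a / t * y"
    using A a t y by (intro mult_mono divide_right_mono) auto
  then have "K / (t * sqrt t) \<le> A * a / t * y" by simp
  moreover have "A * y * (1 - 2 * a / t) + A * a / t * y = A * (y * (1 - a / t))"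
    by (simp add: algebra_simps)
  ultimately show ?thesis using s1 unfolding y_def by linarith
qed

context pps begin

lemma jump_cong: "(\<And>S. S \<in> msets \<Longrightarrow> f S = g S) \<Longrightarrow> S \<in> msets \<Longrightarrow> a \<in> S \<Longrightarrow> jump f S a = jump g S a"
  unfolding jump_def by (rule integral_pmf_cong) (simp add: swap_msets)

lemma mean_obs_cong: "(\<And>S. S \<in> msets \<Longrightarrow> f S = g S) \<Longrightarrow> mean_obs t f = mean_obs t g"
proof -
  assume eq: "\<And>S. S \<in> msets \<Longrightarrow> f S = g S"
  have "obs t f = obs t g"
  proof
    fix s
    show "obs t f s = obs t g s"
      using label_in[of s]
      by (simp add: obs_def corr_def eq lab_msets jump_cong[OF eq] cong: if_cong)
  qed
  then show ?thesis by (simp add: mean_obs_def)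
qed

lemma mean_obs_abs_le:
  fixes b :: real
  assumes b: "bdd f b" and t: "t \<ge> 1"
  shows "\<bar>mean_obs t f\<bar> \<le> b * (1 + 2 * real m ^ 2 / gam)"
  unfolding mean_obs_def
proof (rule integral_pmf_abs_le)
  fix s assume "s \<in> set_pmf (uss_dist m D t)"
  then have "\<bar>obs t f s\<bar> \<le> b + (m / t) * (2 * b / gam * (m * t))"
    by (intro obs_bounded[OF b] total_dist)
  also have "\<dots> = b * (1 + 2 * real m ^ 2 / gam)"
    using t by (simp add: power2_eq_square distrib_left mult_ac)
  finally show "\<bar>obs t f s\<bar> \<le> b * (1 + 2 * real m ^ 2 / gam)" .
qed

text \<open>Induction over \<open>t\<close> for all \<open>f\<close> at once: the value at
  \<open>Suc t\<close> for \<open>f\<close> is, up to the error, the value at \<open>t\<close> for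
  \<open>f + gen f / t\<close>, whose seminorm is smaller by the factor \<open>1 - kap / t\<close>.
  The error is also proportional to \<open>c\<close>, so one \<open>A\<close> serves all
  \<open>f\<close>.\<close>

lemma mean_obs_gen_decay:
  "\<exists>A\<ge>0. \<forall>t\<ge>2 * m. \<forall>f b c. bdd f b \<longrightarrow> lip f c \<longrightarrow> 0 \<le> c \<longrightarrow> \<bar>mean_obs t (gen f)\<bar> \<le> A * t powr (- (kap / 2)) * c"
proof -
  define a where "a = kap / 2"
  have a: "0 < a" "a \<le> 1 / 2" using kap_pos kap_le by (auto simp: a_def)
  define K where "K = err * (2 * real m * real m)"
  define B where "B = 2 * real m * real m * (1 + 2 * real m ^ 2 / gam)"
  \<comment> \<open>The first summand gives \<open>K <= A * a\<close> for the induction step, the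
    second covers the start at \<open>2 * m\<close>, the first time at which the contraction
    applies.\<close>
  define A where "A = K / a + B * (2 * m) powr a"
  have K0: "K \<ge> 0" using err_nonneg by (simp add: K_def)
  have B0: "B \<ge> 0" using gam_pos by (simp add: B_def)
  have A0: "A \<ge> 0" using K0 B0 a by (simp add: A_def)
  have AK: "K \<le> A * a" using a B0 by (simp add: A_def distrib_right)
  have AB: "B \<le> A * (2 * m) powr (- a)"
  proof -
    have "B = B * (2 * m) powr a * (2 * m) powr (- a)" using m_pos by (simp add: powr_minus)
    also have "\<dots> \<le> A * (2 * m) powr (- a)"
      by (rule mult_right_mono) (use K0 a in \<open>simp_all add: A_def\<close>)
    finally show ?thesis .
  qed
  have "\<forall>f b c. bdd f b \<longrightarrow> lip f c \<longrightarrow> 0 \<le> c \<longrightarrow> \<bar>mean_obs t (gen f)\<bar> \<le> A * t powr (- a) * c" if "t \<ge> 2 * m" for t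
    using that
  proof (induction t rule: dec_induct)
    case base
    show ?case
    proof (intro allI impI)
      fix f b c assume f: "bdd f b" "lip f c" "0 \<le> (c::real)"
      have "\<bar>mean_obs (2 * m) (gen f)\<bar> \<le> 2 * real m * real m * c * (1 + 2 * real m ^ 2 / gam)"
        by (rule mean_obs_abs_le[OF lip_gen_bdd[OF f]]) (use m_pos in simp)
      also have "\<dots> = B * c" by (simp add: B_def)
      also have "\<dots> \<le> A * (2 * m) powr (- a) * c" using AB f(3) by (rule mult_right_mono)
      finally show "\<bar>mean_obs (2 * m) (gen f)\<bar> \<le> A * real (2 * m) powr (- a) * c" by simp
    qed
  next
    case (step t)
    show ?case
    proof (intro allI impI)
      fix f b c assume f: "bdd f b" "lip f c" "0 \<le> (c::real)"
      have t1: "t \<ge> 1" and t2: "real t \<ge> 2 * real m" using step(1) m_pos by (auto simp flip: of_nat_mult)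
      define f' where "f' = (\<lambda>S. f S + (1 / real t) * gen f S)"
      have bg: "bdd (gen f) (2 * real m * b)" by (rule gen_bdd[OF f(1)])
      have bf': "bdd f' (b + \<bar>1 / real t\<bar> * (2 * real m * b))" unfolding f'_def by (rule bdd_add[OF f(1) bg])
      have lf': "lip f' (c * (1 - kap / t))" unfolding f'_def by (rule lip_contraction[OF f t2])
      have "kap / t \<le> 1" using kap_le kap_pos t1 by (simp add: field_simps)
      then have c': "0 \<le> c * (1 - kap / t)" using f(3) by simp
      have bgc: "bdd (gen f) (2 * real m * real m * c)" by (rule lip_gen_bdd[OF f])
      \<comment> \<open>\<open>gen\<close> commutes with the step \<open>f + gen f / t\<close>, so
        the recursion for the test function \<open>gen f\<close> is governed by
        \<open>gen f'\<close>.\<close>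
      have "mean_obs t (gen f') = mean_obs t (\<lambda>S. gen f S + (1 / real t) * gen (gen f) S)"
        unfolding f'_def by (rule mean_obs_cong) (rule gen_linear[OF f(1) bg])
      also have "\<dots> = mean_obs t (gen f) + mean_obs t (gen (gen f)) / t"
        using mean_obs_linear[OF bg gen_bdd[OF bg], of t "1 / real t"] by simp
      finally have eq: "mean_obs t (gen f) + mean_obs t (gen (gen f)) / t = mean_obs t (gen f')" by simp
      have "\<bar>mean_obs (Suc t) (gen f)\<bar> \<le> \<bar>mean_obs t (gen f')\<bar> + err * (2 * real m * real m * c) / (t * sqrt t)"
        using mean_obs_Suc[OF bgc t1] unfolding eq by linarith
      also have "\<bar>mean_obs t (gen f')\<bar> \<le> A * t powr (- a) * (c * (1 - kap / t))"
        using step.IH bf' lf' c' by blast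
      also have "A * t powr (- a) * (c * (1 - kap / t)) + err * (2 * real m * real m * c) / (t * sqrt t)
          = c * (A * t powr (- a) * (1 - 2 * a / t) + K / (t * sqrt t))"
        by (simp add: K_def a_def algebra_simps)
      also have "\<dots> \<le> c * (A * (real t + 1) powr (- a))"
        by (intro mult_left_mono powr_decay_step a AK A0 K0 f(3)) (use t1 in simp)
      finally show "\<bar>mean_obs (Suc t) (gen f)\<bar> \<le> A * real (Suc t) powr (- a) * c"
        by (simp add: add.commute mult_ac)
    qed
  qed
  then show ?thesis using A0 unfolding a_def by blast
qed

section \<open>Limits of the means and the limit law\<close>

lemma sqrt_tendsto: "(\<lambda>t. c / sqrt (real t)) \<longlonglongrightarrow> 0"
  by (intro tendsto_divide_0[OF tendsto_const] filterlim_at_top_imp_at_infinity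
      filterlim_compose[OF sqrt_at_top] filterlim_real_sequentially)

lemma mean_obs_lab_tendsto:
  assumes b: "bdd f b"
  shows "(\<lambda>t. E t (\<lambda>s. f (lab s)) - mean_obs t f) \<longlonglongrightarrow> 0"
proof (rule Lim_null_comparison[OF _ sqrt_tendsto])
  show "\<forall>\<^sub>F t in sequentially. norm (E t (\<lambda>s. f (lab s)) - mean_obs t f) \<le> (2 * real m ^ 2 / gam * b) / sqrt t"
    using eventually_ge_at_top[of 1]
    by eventually_elim (use mean_obs_lab[OF b] in \<open>simp add: abs_minus_commute\<close>)
qed

lemma E_gen_tendsto:
  assumes b: "bdd f b"
  shows "(\<lambda>t. E t (\<lambda>s. gen f (lab s))) \<longlonglongrightarrow> 0"
proof -
  obtain A where A: "A \<ge> 0" "\<forall>t\<ge>2 * m. \<forall>f b c. bdd f b \<longrightarrow> lip f c \<longrightarrow> 0 \<le> c \<longrightarrow> \<bar>mean_obs t (gen f)\<bar> \<le> A * t powr (- (kap / 2)) * c"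
    using mean_obs_gen_decay by blast
  have "(\<lambda>t. mean_obs t (gen f)) \<longlonglongrightarrow> 0"
  proof (rule Lim_null_comparison)
    show "\<forall>\<^sub>F t in sequentially. norm (mean_obs t (gen f)) \<le> A * real t powr (- (kap / 2)) * (2 * b)"
      using eventually_ge_at_top[of "2 * m"]
      by eventually_elim (use A(2) b bdd_lip[OF b] bdd_nonneg[OF b] in force)
    have "(\<lambda>t. real t powr (- (kap / 2))) \<longlonglongrightarrow> 0"
      by (rule tendsto_neg_powr) (use kap_pos filterlim_real_sequentially in auto)
    then show "(\<lambda>t. A * real t powr (- (kap / 2)) * (2 * b)) \<longlonglongrightarrow> 0"
      by (intro tendsto_mult_left_zero tendsto_mult_right_zero)
  qed
  from tendsto_add[OF mean_obs_lab_tendsto[OF gen_bdd[OF b]] this] show ?thesis by simp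
qed

lemma E_lab_convergent:
  assumes b: "bdd f b"
  shows "convergent (\<lambda>t. E t (\<lambda>s. f (lab s)))"
proof -
  obtain A where A: "A \<ge> 0" "\<forall>t\<ge>2 * m. \<forall>f b c. bdd f b \<longrightarrow> lip f c \<longrightarrow> 0 \<le> c \<longrightarrow> \<bar>mean_obs t (gen f)\<bar> \<le> A * t powr (- (kap / 2)) * c"
    using mean_obs_gen_decay by blast
  have b0: "b \<ge> 0" by (rule bdd_nonneg[OF b])
  have "summable (\<lambda>t. mean_obs (Suc t) f - mean_obs t f)"
  proof (rule summable_comparison_test_ev)
    show "summable (\<lambda>t. (A * (2 * b) + err * b) * real t powr (- 1 - kap / 2))"
      by (intro summable_mult) (use kap_pos in \<open>simp add: summable_real_powr_iff\<close>)
    show "\<forall>\<^sub>F t in sequentially. norm (mean_obs (Suc t) f - mean_obs t f) \<le> (A * (2 * b) + err * b) * real t powr (- 1 - kap / 2)"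
      using eventually_ge_at_top[of "2 * m"]
    proof eventually_elim
      case (elim t)
      have t1: "t \<ge> 1" using elim m_pos by simp
      have tp: "real t > 0" using t1 by simp
      have p: "real t powr (- 1 - kap / 2) = real t powr (- (kap / 2)) / t"
        using tp by (simp add: powr_diff powr_minus_divide)
      have "\<bar>mean_obs t (gen f)\<bar> \<le> A * t powr (- (kap / 2)) * (2 * b)"
        using A(2) elim b bdd_lip[OF b] b0 by force
      then have 1: "\<bar>mean_obs t (gen f) / t\<bar> \<le> A * (2 * b) * real t powr (- 1 - kap / 2)"
        unfolding p using tp by (simp add: field_simps)
      \<comment> \<open>Since \<open>kap <= 1\<close>, the error of order
        \<open>t powr (- 3 / 2)\<close> fits under the same summable power as the main term.\<close>
      have "1 / sqrt t = t powr (- (1 / 2))" using tp by (simp add: powr_minus_divide powr_half_sqrt)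
      also have "\<dots> \<le> t powr (- (kap / 2))" using t1 kap_le by (intro powr_mono) auto
      finally have "err * b / t * (1 / sqrt t) \<le> err * b / t * t powr (- (kap / 2))"
        using err_nonneg b0 by (intro mult_left_mono) auto
      then have 2: "err * b / (t * sqrt t) \<le> err * b * real t powr (- 1 - kap / 2)"
        unfolding p by simp
      show ?case using mean_obs_Suc[OF b t1] 1 2 unfolding real_norm_def distrib_right by linarith
    qed
  qed
  then have "convergent (\<lambda>n. mean_obs n f - mean_obs 0 f)"
    unfolding summable_iff_convergent sum_lessThan_telescope[of "\<lambda>n. mean_obs n f"] .
  then have "convergent (\<lambda>t. mean_obs t f)" using convergent_diff_const_right_iff[of "\<lambda>n. mean_obs n f" "mean_obs 0 f"] by simp
  then have "convergent (\<lambda>t. (E t (\<lambda>s. f (lab s)) - mean_obs t f) + mean_obs t f)"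
    by (intro convergent_add convergentI[OF mean_obs_lab_tendsto[OF b]])
  then show ?thesis by simp
qed

lemma E_card_tendsto: "(\<lambda>t. E t (\<lambda>s. real (card (lab s \<inter> A)))) \<longlonglongrightarrow> m * P A"
proof -
  define f where "f = (\<lambda>S. real (card (S \<inter> A)))"
  have b: "bdd f m"
    unfolding bdd_def f_def msets_def using card_mono[of _ "_ \<inter> A"] by fastforce
  have i: "integrable (measure_pmf (uss_dist m D t)) (\<lambda>s. f (lab s))" for t
    by (rule integrable_pmf_bounded[where B = m]) (use b lab_msets in \<open>simp add: bdd_def\<close>)
  have "E t (\<lambda>s. gen f (lab s)) = E t (\<lambda>s. m * P A - f (lab s))" for t
    by (rule integral_pmf_cong) (simp add: f_def gen_card_inter[OF lab_msets])
  then have "E t (\<lambda>s. gen f (lab s)) = m * P A - E t (\<lambda>s. f (lab s))" for t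
    using i by simp
  then have "(\<lambda>t. m * P A - E t (\<lambda>s. f (lab s))) \<longlonglongrightarrow> 0" using E_gen_tendsto[OF b] by simp
  from tendsto_diff[OF tendsto_const[of "m * P A"] this] show ?thesis by (simp add: f_def)
qed

text \<open>The placeholder in \<open>lab\<close> is used only while some bin has count
  \<open>0\<close>, where the risk is at least \<open>t / m\<close>; Markov's inequality applied to
  the risk then bounds the probability.\<close>

lemma prob_not_full_tendsto: "(\<lambda>t. measure_pmf.prob (uss_dist m D t) {s. uss_labels m s \<noteq> lab s}) \<longlonglongrightarrow> 0"
proof (rule Lim_null_comparison[OF _ sqrt_tendsto])
  show "\<forall>\<^sub>F t in sequentially. norm (measure_pmf.prob (uss_dist m D t) {s. uss_labels m s \<noteq> lab s})
      \<le> (m * (4 * real m ^ 2 + 224 * real m ^ 5)) / sqrt t"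
    using eventually_ge_at_top[of 1]
  proof eventually_elim
    case (elim t)
    have tp: "real t > 0" using elim by simp
    have "measure_pmf.prob (uss_dist m D t) {s. uss_labels m s \<noteq> lab s} = E t (indicator {s. uss_labels m s \<noteq> lab s})"
      by simp
    also have "\<dots> \<le> E t (\<lambda>s. m / t * risk t s)"
    proof (rule E_mono)
      show "integrable (measure_pmf (uss_dist m D t)) (\<lambda>s. m / t * risk t s)"
        by (intro integrable_mult_right risk_integrable)
      fix s assume i: "valid t s"
      show "indicator {s. uss_labels m s \<noteq> lab s} s \<le> m / t * risk t s"
      proof (cases "uss_labels m s = lab s")
        case False
        then have "uss_labels m s \<notin> msets" by (auto simp: lab_def)
        then have N0: "mincount (snd s) = 0" using full_labels[OF i] by auto
        obtain k where k: "k < m" "snd s k = 0" using minbins_ne[of "snd s"] N0 by (auto simp: minbins_def)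
        have "t / m \<le> absdev t s" using abs_dev_absdev[OF k(1), of t s] k by (simp add: dev_def)
        then have "t / m \<le> risk t s" using N0 by (simp add: risk_def)
        then show ?thesis using tp m_pos by (simp add: field_simps indicator_def)
      qed (simp add: risk_nonneg)
    qed simp
    also have "\<dots> = m / t * E t (risk t)" by simp
    also have "\<dots> \<le> m / 1 * ((4 * real m ^ 2 + 224 * real m ^ 5) / sqrt t)"
      using elim E_risk[OF elim] by (intro mult_mono divide_left_mono integral_nonneg_AE) (auto simp: risk_nonneg)
    finally show ?case by simp
  qed
qed

lemma limit_sample:
  "\<exists>\<mu>. (\<forall>S. (\<lambda>t. pmf (map_pmf (uss_labels m) (uss_dist m D t)) S) \<longlonglongrightarrow> pmf \<mu> S) \<and> is_pps_sample m (pmf D) \<mu>"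
proof -
  define M where "M = (\<lambda>t. map_pmf lab (uss_dist m D t))"
  have prob: "measure_pmf.prob (M t) X = E t (\<lambda>s. indicator X (lab s))" for t X
  proof -
    have "E t (\<lambda>s. indicator X (lab s)) = E t (indicator (lab -` X))"
      by (rule integral_pmf_cong) (simp add: indicator_def)
    then show ?thesis by (simp add: M_def)
  qed
  have "\<exists>l. (\<lambda>t. measure_pmf.prob (M t) X) \<longlonglongrightarrow> l" for X
  proof -
    have "bdd (indicator X) 1" by (simp add: bdd_def indicator_def)
    then have "convergent (\<lambda>t. measure_pmf.prob (M t) X)" unfolding prob by (rule E_lab_convergent)
    then show ?thesis by (simp add: convergent_def)
  qed
  then obtain l where l: "\<And>X. (\<lambda>t. measure_pmf.prob (M t) X) \<longlonglongrightarrow> l X" by metis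
  have card_int: "integrable (measure_pmf (uss_dist m D t)) (\<lambda>s. real (card (lab s \<inter> A)))" for t A
  proof (rule integrable_pmf_bounded)
    fix s
    have "finite (lab s)" "card (lab s) = m" using lab_msets[of s] by (auto simp: msets_def)
    then show "\<bar>real (card (lab s \<inter> A))\<bar> \<le> m" using card_mono[of "lab s" "lab s \<inter> A"] by auto
  qed
  have tight: "\<exists>F. finite F \<and> 1 - e \<le> l F" if e: "e > 0" for e
  proof -
    have "(\<lambda>J. P {..<J}) \<longlonglongrightarrow> P (\<Union>J. {..<J})"
      by (rule measure_pmf.finite_Lim_measure_incseq) (auto simp: incseq_def)
    also have "(\<Union>J. {..<J}) = (UNIV :: nat set)" by auto
    finally have "(\<lambda>J. P {..<J}) \<longlonglongrightarrow> 1" by simp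
    then have "\<forall>\<^sub>F J in sequentially. 1 - e / m < P {..<J}"
      by (rule order_tendstoD) (use e m_pos in simp)
    then obtain J where J: "1 - e / m < P {..<J}" by (auto simp: eventually_at_top_linorder)
    define F where "F = msets \<inter> Pow {..<J}"
    have "finite F" by (simp add: F_def)
    moreover have "1 - e \<le> l F"
    proof -
      \<comment> \<open>A label set outside \<open>F\<close> contains an item \<open>>= J\<close>,
        so the expected number of such items bounds the escaping mass. It tends to
        \<open>m * P {J..}\<close>, below \<open>e\<close> by the choice of
        \<open>J\<close>.\<close>
      have "1 - E t (\<lambda>s. real (card (lab s \<inter> {J..}))) \<le> measure_pmf.prob (M t) F" for t
      proof -
        have "1 - E t (\<lambda>s. real (card (lab s \<inter> {J..}))) = E t (\<lambda>s. 1 - real (card (lab s \<inter> {J..})))"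
          using card_int by simp
        also have "\<dots> \<le> E t (\<lambda>s. indicator F (lab s))"
        proof (rule integral_pmf_mono)
          show "integrable (measure_pmf (uss_dist m D t)) (\<lambda>s. 1 - real (card (lab s \<inter> {J..})))"
            using card_int by simp
          show "integrable (measure_pmf (uss_dist m D t)) (\<lambda>s. indicator F (lab s) :: real)"
            by (rule integrable_pmf_bounded[where B = 1]) (simp add: indicator_def)
          fix s
          have fin: "finite (lab s)" using lab_msets[of s] by (simp add: msets_def)
          show "1 - real (card (lab s \<inter> {J..})) \<le> indicator F (lab s)"
          proof (cases "lab s \<in> F")
            case False
            then have "lab s \<inter> {J..} \<noteq> {}" using lab_msets[of s] by (auto simp: F_def not_less)
            then have "card (lab s \<inter> {J..}) > 0" using fin by (simp add: card_gt_0_iff)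
            then show ?thesis using False by simp
          qed simp
        qed
        finally show ?thesis by (simp add: prob)
      qed
      then have "1 - m * P {J..} \<le> l F"
        by (intro LIMSEQ_le[OF tendsto_diff[OF tendsto_const E_card_tendsto] l]) auto
      moreover have "P {J..} = 1 - P {..<J}"
        using measure_pmf.prob_compl[of "{..<J}" D] by (simp add: Compl_eq_Diff_UNIV[symmetric])
      moreover have "m * (1 - P {..<J}) \<le> m * (e / m)" using J by (intro mult_left_mono) auto
      ultimately show ?thesis using m_pos by simp
    qed
    ultimately show ?thesis by blast
  qed
  obtain \<mu> where mu: "\<And>X. measure_pmf.prob \<mu> X = l X"
    using pmf_limit_exists[OF l tight] by blast
  have conv: "(\<lambda>t. pmf (map_pmf (uss_labels m) (uss_dist m D t)) S) \<longlonglongrightarrow> pmf \<mu> S" for S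
  proof -
    \<comment> \<open>Transfer from \<open>lab\<close> to the true label set: the two probabilities
      differ by at most the probability that the sets differ.\<close>
    have "(\<lambda>t. pmf (map_pmf (uss_labels m) (uss_dist m D t)) S - measure_pmf.prob (M t) {S}) \<longlonglongrightarrow> 0"
    proof (rule Lim_null_comparison[OF _ prob_not_full_tendsto])
      show "\<forall>\<^sub>F t in sequentially. norm (pmf (map_pmf (uss_labels m) (uss_dist m D t)) S - measure_pmf.prob (M t) {S})
          \<le> measure_pmf.prob (uss_dist m D t) {s. uss_labels m s \<noteq> lab s}"
      proof (rule always_eventually, rule allI)
        fix t
        let ?Q = "measure_pmf.prob (uss_dist m D t)"
        let ?N = "{s. uss_labels m s \<noteq> lab s}"
        have "pmf (map_pmf (uss_labels m) (uss_dist m D t)) S = ?Q (uss_labels m -` {S})" by (simp add: pmf_map)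
        moreover have "measure_pmf.prob (M t) {S} = ?Q (lab -` {S})" by (simp add: M_def)
        moreover have "?Q (uss_labels m -` {S}) \<le> ?Q (lab -` {S} \<union> ?N)" "?Q (lab -` {S}) \<le> ?Q (uss_labels m -` {S} \<union> ?N)"
          by (rule measure_pmf.finite_measure_mono; auto)+
        moreover have "?Q (X \<union> ?N) \<le> ?Q X + ?Q ?N" for X
          by (rule measure_Un_le) auto
        ultimately show "norm (pmf (map_pmf (uss_labels m) (uss_dist m D t)) S - measure_pmf.prob (M t) {S}) \<le> ?Q ?N"
          unfolding real_norm_def abs_le_iff by (smt (verit))
      qed
    qed
    from tendsto_add[OF this l[of "{S}"]] show ?thesis by (simp add: mu[symmetric] measure_pmf_single)
  qed
  have "is_pps_sample m (pmf D) \<mu>"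
    unfolding is_pps_sample_def
  proof (intro conjI ballI allI)
    have "measure_pmf.prob (M t) msets = 1" for t
      unfolding prob by (simp add: lab_msets)
    then have "l msets = 1" using l[of msets] LIMSEQ_unique[OF _ tendsto_const] by simp
    then have "AE S in measure_pmf \<mu>. S \<in> msets"
      using measure_pmf.prob_eq_1[of msets \<mu>] mu by simp
    then show "finite S" "card S = m" if "S \<in> set_pmf \<mu>" for S
      using that by (auto simp: AE_measure_pmf_iff msets_def)
    fix j
    have "E t (\<lambda>s. real (card (lab s \<inter> {j}))) = measure_pmf.prob (M t) {S. j \<in> S}" for t
      unfolding prob by (rule integral_pmf_cong) (simp add: indicator_def)
    then have "(\<lambda>t. measure_pmf.prob (M t) {S. j \<in> S}) \<longlonglongrightarrow> m * P {j}"
      using E_card_tendsto[of "{j}"] by simp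
    then show "measure_pmf.prob \<mu> {S. j \<in> S} = real m * pmf D j"
      using LIMSEQ_unique[OF l] by (simp add: mu measure_pmf_single)
  qed
  then show ?thesis using conv by blast
qed

end

theorem theorem4:
  fixes m :: nat and D :: "nat pmf"
  assumes "m > 0"
    and "antimono (pmf D)"
    and "pmf D 0 < 1 / real m"
  shows "\<exists>\<mu> :: nat set pmf.
           (\<forall>S. (\<lambda>t. pmf (map_pmf (uss_labels m) (uss_dist m D t)) S) \<longlonglongrightarrow> pmf \<mu> S)
           \<and> is_pps_sample m (pmf D) \<mu>"
proof -
  interpret pps m D by unfold_locales (rule assms)+
  show ?thesis by (rule limit_sample)
qed

end
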